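(* Let $M$ be $\mathbb{N}$ or $\mathbb{Z}$, let $k$ be a field of characteristic zero, and let $k_0 \subset k$ be a computable subfield. Then the following problem is undecidable: given a finite system of difference equations $F = 0$ and a difference equation $g = 0$, both with coefficients in $k_0$ (in the same finite tuple of unknowns), determine whether $g = 0$ holds for every solution of $F = 0$ in $k^M$.
   Context: $\mathbb{N}$ is the set of nonnegative integers. For $M=\mathbb{N}$ or $\mathbb{Z}$, the ring $k^M$ of sequences has componentwise operations and shift endomorphism $\sigma((x_i)_{i\in M})=(x_{i+1})_{i\in M}$; $k$ embeds as the constant sequences. A difference polynomial over $k_0$ in unknowns $\mathbf{X}=(X_1,\ldots,X_n)$ is an element of the polynomial ring $k_0[\sigma^j(X_1),\ldots,\sigma^j(X_n)\mid j\in\mathbb{N}]$ (in the indeterminates $\sigma^j(X_i)$), on which $\sigma$ acts trivially on $k_0$ and by $\sigma(\sigma^j(X_i))=\sigma^{j+1}(X_i)$. For $\mathbf{x}\in(k^M)^n$, a difference polynomial $f$ is evaluated at $\mathbf{x}$ by the unique $k_0$-algebra morphism $k_0[\sigma^j(\mathbf{X})\mid j\in\mathbb{N}]\to k^M$ commuting with $\sigma$ and sending $X_i\mapsto x_i$; $f=0$ holds for $\mathbf{x}$ if this value is the zero sequence, and $\mathbf{x}$ is a solution of $F=0$ if $f=0$ holds for $\mathbf{x}$ for all $f\in F$. "Undecidable" means that no algorithm solves the problem. *)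

theory Defs
  imports
    "HOL-Library.Poly_Mapping"
    "HOL-Library.Function_Algebras"
    "HOL-Library.FuncSet"
    "HOL-Library.Nat_Bijection"
begin

section \<open>Partial recursive functions\<close>

text \<open>
  Algorithms are partial recursive functions on the natural numbers, given by their usual
  descriptions: \<open>recf_result p xs y\<close> says that the function described by \<open>p\<close> is defined on the
  argument list \<open>xs\<close>, with value \<open>y\<close>.  A description has no fixed arity; on an argument list of
  unsuitable length it may be undefined.
\<close>

datatype recf =
    Zero
  | Succ
  | Proj nat
  | Comp recf "recf list"
  | PrimRec recf recf
  | Mu recf

inductive recf_result :: "recf \<Rightarrow> nat list \<Rightarrow> nat \<Rightarrow> bool" where
  Zero: "recf_result Zero xs 0"
| Succ: "recf_result Succ [x] (Suc x)"
| Proj: "i < length xs \<Longrightarrow> recf_result (Proj i) xs (xs ! i)"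
| Comp: "list_all2 (\<lambda>q y. recf_result q xs y) qs ys \<Longrightarrow> recf_result p ys z \<Longrightarrow>
    recf_result (Comp p qs) xs z"
| PrimRec_0: "recf_result p xs y \<Longrightarrow> recf_result (PrimRec p q) (0 # xs) y"
| PrimRec_Suc: "recf_result (PrimRec p q) (n # xs) r \<Longrightarrow> recf_result q (n # r # xs) y \<Longrightarrow>
    recf_result (PrimRec p q) (Suc n # xs) y"
| Mu: "recf_result p (n # xs) 0 \<Longrightarrow> (\<forall>m<n. \<exists>y>0. recf_result p (m # xs) y) \<Longrightarrow>
    recf_result (Mu p) xs n"

lemma recf_result_unique:
  "recf_result p xs y \<Longrightarrow> recf_result p xs z \<Longrightarrow> y = z"
proof (induction arbitrary: z rule: recf_result.induct)
  case (Comp xs qs ys p w)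
  from Comp.prems obtain ys' where ys': "list_all2 (\<lambda>q y. recf_result q xs y) qs ys'"
    and z: "recf_result p ys' z"
    by (auto elim: recf_result.cases)
  have "ys = ys'"
  proof (rule nth_equalityI)
    show "length ys = length ys'"
      using Comp.IH(1) ys' by (simp add: list_all2_conv_all_nth)
    show "ys ! i = ys' ! i" if "i < length ys" for i
      using Comp.IH(1) ys' that by (simp add: list_all2_conv_all_nth)
  qed
  with Comp.IH(2) z show ?case by blast
next
  case (PrimRec_0 p xs y q)
  from PrimRec_0.prems show ?case
    by (cases rule: recf_result.cases) (auto intro: PrimRec_0.IH)
next
  case (PrimRec_Suc p q n xs r y)
  from PrimRec_Suc.prems show ?case
    by (cases rule: recf_result.cases) (use PrimRec_Suc.IH in blast)
next
  case (Mu p n xs)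
  from Mu.prems obtain z: "recf_result p (z # xs) 0" and
    less: "\<forall>m<z. \<exists>y>0. recf_result p (m # xs) y"
    by (auto elim: recf_result.cases)
  have "\<not> n < z" using Mu.IH(1) less by (metis less_irrefl)
  moreover have "\<not> z < n" using Mu.IH(2) z by (metis less_irrefl)
  ultimately show ?case by simp
qed (auto elim: recf_result.cases)

definition computable1 :: "(nat \<Rightarrow> nat) \<Rightarrow> bool" where
  "computable1 h \<longleftrightarrow> (\<exists>p. \<forall>x. recf_result p [x] (h x))"

definition computable2 :: "(nat \<Rightarrow> nat \<Rightarrow> nat) \<Rightarrow> bool" where
  "computable2 h \<longleftrightarrow> (\<exists>p. \<forall>x y. recf_result p [x, y] (h x y))"


section \<open>Computable subfields\<close>

definition is_subfield :: "'a::field set \<Rightarrow> bool" where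
  "is_subfield K \<longleftrightarrow> 0 \<in> K \<and> 1 \<in> K \<and>
     (\<forall>a\<in>K. \<forall>b\<in>K. a + b \<in> K \<and> a * b \<in> K) \<and> (\<forall>a\<in>K. - a \<in> K \<and> inverse a \<in> K)"

text \<open>
  A computable field is a field whose elements are named by natural numbers in such a way that
  equality is decidable and the field operations are computable on names.  An element may have
  several names, so explicit codings such as fractions are covered; an injective coding onto an
  infinite decidable set of natural numbers yields such a numbering by listing that set.  The
  convention \<open>inverse 0 = 0\<close> is harmless, because the names of \<open>0\<close> form a decidable set.
\<close>

definition computable_numbering :: "'a::field set \<Rightarrow> (nat \<Rightarrow> 'a) \<Rightarrow> bool" where
  "computable_numbering K \<nu> \<longleftrightarrow>
     range \<nu> = K \<and>
     computable2 (\<lambda>x y. if \<nu> x = \<nu> y then 1 else 0) \<and>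
     (\<exists>h. computable2 h \<and> (\<forall>x y. \<nu> (h x y) = \<nu> x + \<nu> y)) \<and>
     (\<exists>h. computable2 h \<and> (\<forall>x y. \<nu> (h x y) = \<nu> x * \<nu> y)) \<and>
     (\<exists>h. computable1 h \<and> (\<forall>x. \<nu> (h x) = - \<nu> x)) \<and>
     (\<exists>h. computable1 h \<and> (\<forall>x. \<nu> (h x) = inverse (\<nu> x)))"


section \<open>Difference polynomials and their values at tuples of sequences\<close>

text \<open>
  The ring \<open>k\<^sup>M\<close> is the type \<open>'m \<Rightarrow> 'a\<close> with the pointwise operations, where \<open>'m\<close> is
  \<^typ>\<open>nat\<close> or \<^typ>\<open>int\<close>.
\<close>

definition seq_shift :: "('m::semiring_1 \<Rightarrow> 'a) \<Rightarrow> 'm \<Rightarrow> 'a" where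
  "seq_shift x = (\<lambda>i. x (i + 1))"

definition const_seq :: "'a \<Rightarrow> 'm \<Rightarrow> 'a" where
  "const_seq a = (\<lambda>_. a)"

text \<open>
  The indeterminate \<open>\<sigma>\<^sup>j(X\<^sub>i)\<close> is the pair \<open>(i, j)\<close>, with \<open>i\<close> counted from \<open>0\<close>.  Monomials map
  indeterminates to exponents, and polynomials map monomials to coefficients.
\<close>

type_synonym dmonom = "(nat \<times> nat) \<Rightarrow>\<^sub>0 nat"
type_synonym 'a dpoly = "dmonom \<Rightarrow>\<^sub>0 'a"

definition dpolys :: "'a::field set \<Rightarrow> nat \<Rightarrow> 'a dpoly set" where
  "dpolys K n = {f. (\<forall>m. Poly_Mapping.lookup f m \<in> K) \<and>
     (\<forall>m\<in>Poly_Mapping.keys f. \<forall>v\<in>Poly_Mapping.keys m. fst v < n)}"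

definition dconst :: "'a::field \<Rightarrow> 'a dpoly" where
  "dconst a = Poly_Mapping.single 0 a"

definition dvar :: "nat \<Rightarrow> nat \<Rightarrow> 'a::field dpoly" where
  "dvar i j = Poly_Mapping.single (Poly_Mapping.single (i, j) 1) 1"

definition dmonom_shift :: "dmonom \<Rightarrow> dmonom" where
  "dmonom_shift m = (\<Sum>v\<in>Poly_Mapping.keys m.
     Poly_Mapping.single (fst v, Suc (snd v)) (Poly_Mapping.lookup m v))"

definition dpoly_shift :: "'a::field dpoly \<Rightarrow> 'a dpoly" where
  "dpoly_shift f = (\<Sum>m\<in>Poly_Mapping.keys f.
     Poly_Mapping.single (dmonom_shift m) (Poly_Mapping.lookup f m))"

definition dmonom_eval ::
    "(nat \<Rightarrow> 'm::semiring_1 \<Rightarrow> 'a::field) \<Rightarrow> dmonom \<Rightarrow> 'm \<Rightarrow> 'a" where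
  "dmonom_eval x m = (\<Prod>v\<in>Poly_Mapping.keys m.
     ((seq_shift ^^ snd v) (x (fst v))) ^ Poly_Mapping.lookup m v)"

text \<open>
  The value of a difference polynomial is given by the explicit formula; that this is the unique
  algebra morphism commuting with the shifts and sending \<open>X\<^sub>i\<close> to \<open>x\<^sub>i\<close> is proved in the lemmas
  \<open>dpoly_eval_morphism\<close> and \<open>dpoly_eval_unique\<close>.
\<close>

definition dpoly_eval ::
    "(nat \<Rightarrow> 'm::semiring_1 \<Rightarrow> 'a::field) \<Rightarrow> 'a dpoly \<Rightarrow> 'm \<Rightarrow> 'a" where
  "dpoly_eval x f = (\<Sum>m\<in>Poly_Mapping.keys f.
     const_seq (Poly_Mapping.lookup f m) * dmonom_eval x m)"

lemma pm_induct [case_names zero add]: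
  fixes f :: "'b \<Rightarrow>\<^sub>0 'c::monoid_add"
  assumes "P 0"
    and add: "\<And>f a b. a \<notin> Poly_Mapping.keys f \<Longrightarrow> b \<noteq> 0 \<Longrightarrow> P f \<Longrightarrow>
      P (f + Poly_Mapping.single a b)"
  shows "P f"
proof (induction f rule: Poly_Mapping.update_induct)
  case const
  show ?case by (rule assms(1))
next
  case (update f a b)
  have "Poly_Mapping.update a b f = f + Poly_Mapping.single a b"
    using update(1)
    by (intro poly_mapping_eqI)
       (auto simp: Poly_Mapping.lookup_update lookup_add lookup_single when_def in_keys_iff)
  with add[OF update(1,2,3)] show ?case by simp
qed

lemma keys_add_single:
  fixes f :: "'b \<Rightarrow>\<^sub>0 'c::monoid_add"
  assumes "a \<notin> Poly_Mapping.keys f" "b \<noteq> 0"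
  shows "Poly_Mapping.keys (f + Poly_Mapping.single a b) = insert a (Poly_Mapping.keys f)"
  using assms by (auto simp: in_keys_iff lookup_add lookup_single when_def split: if_splits)

lemma const_seq_simps:
  "const_seq 0 = 0" "const_seq 1 = 1"
  "const_seq (a + b) = const_seq a + const_seq b"
  "const_seq (a * b) = const_seq a * const_seq b"
  for a b :: "'a::field"
  by (auto simp: const_seq_def fun_eq_iff)

lemma seq_shift_simps:
  fixes x y :: "'m::semiring_1 \<Rightarrow> 'a::field"
  shows "seq_shift 0 = (0 :: 'm \<Rightarrow> 'a)" "seq_shift 1 = (1 :: 'm \<Rightarrow> 'a)"
    "seq_shift (const_seq a) = (const_seq a :: 'm \<Rightarrow> 'a)"
    "seq_shift (x + y) = seq_shift x + seq_shift y"
    "seq_shift (x * y) = seq_shift x * seq_shift y"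
  by (auto simp: seq_shift_def const_seq_def fun_eq_iff)

lemma seq_shift_power: "seq_shift (x ^ n) = seq_shift x ^ n"
  for x :: "'m::semiring_1 \<Rightarrow> 'a::field"
  by (induction n) (simp_all add: seq_shift_simps
    del: one_fun_apply times_fun_apply)

lemma dmonom_eval_superset:
  assumes "finite A" "Poly_Mapping.keys m \<subseteq> A"
  shows "dmonom_eval x m =
    (\<Prod>v\<in>A. ((seq_shift ^^ snd v) (x (fst v))) ^ Poly_Mapping.lookup m v)"
  unfolding dmonom_eval_def
  by (rule prod.mono_neutral_left) (use assms in \<open>auto simp: in_keys_iff\<close>)

lemma dmonom_eval_0 [simp]: "dmonom_eval x 0 = 1"
  by (simp add: dmonom_eval_def)

lemma dmonom_eval_add: "dmonom_eval x (m + m') = dmonom_eval x m * dmonom_eval x m'"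
proof -
  let ?A = "Poly_Mapping.keys m \<union> Poly_Mapping.keys m'"
  have "Poly_Mapping.keys (m + m') \<subseteq> ?A" by (rule Poly_Mapping.keys_add)
  then show ?thesis
    by (simp add: dmonom_eval_superset[of ?A] lookup_add power_add prod.distrib)
qed

lemma dmonom_eval_single:
  "dmonom_eval x (Poly_Mapping.single v e) = ((seq_shift ^^ snd v) (x (fst v))) ^ e"
  by (subst dmonom_eval_superset[of "{v}"]) auto

lemma dmonom_shift_superset:
  assumes "finite A" "Poly_Mapping.keys m \<subseteq> A"
  shows "dmonom_shift m = (\<Sum>v\<in>A.
     Poly_Mapping.single (fst v, Suc (snd v)) (Poly_Mapping.lookup m v))"
  unfolding dmonom_shift_def
  by (rule sum.mono_neutral_left) (use assms in \<open>auto simp: in_keys_iff\<close>)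

lemma dmonom_shift_add: "dmonom_shift (m + m') = dmonom_shift m + dmonom_shift m'"
proof -
  let ?A = "Poly_Mapping.keys m \<union> Poly_Mapping.keys m'"
  have "Poly_Mapping.keys (m + m') \<subseteq> ?A" by (rule Poly_Mapping.keys_add)
  then show ?thesis
    by (simp add: dmonom_shift_superset[of ?A] lookup_add single_add sum.distrib)
qed

lemma dmonom_shift_single:
  "dmonom_shift (Poly_Mapping.single v e) = Poly_Mapping.single (fst v, Suc (snd v)) e"
  by (subst dmonom_shift_superset[of "{v}"]) auto

lemma dmonom_shift_0 [simp]: "dmonom_shift 0 = 0"
  by (simp add: dmonom_shift_def)

lemma dmonom_eval_shift: "dmonom_eval x (dmonom_shift m) = seq_shift (dmonom_eval x m)"
proof (induction m rule: pm_induct)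
  case zero
  then show ?case by (simp add: seq_shift_simps del: one_fun_apply)
next
  case (add m v e)
  then show ?case
    by (simp add: dmonom_shift_add dmonom_eval_add dmonom_shift_single dmonom_eval_single
        seq_shift_simps seq_shift_power del: times_fun_apply)
qed

lemma dpoly_eval_superset:
  assumes "finite A" "Poly_Mapping.keys f \<subseteq> A"
  shows "dpoly_eval x f = (\<Sum>m\<in>A. const_seq (Poly_Mapping.lookup f m) * dmonom_eval x m)"
  unfolding dpoly_eval_def
  by (rule sum.mono_neutral_left) (use assms in \<open>auto simp: in_keys_iff const_seq_simps\<close>)

lemma dpoly_eval_0 [simp]: "dpoly_eval x 0 = 0"
  by (simp add: dpoly_eval_def)

lemma dpoly_eval_add: "dpoly_eval x (f + g) = dpoly_eval x f + dpoly_eval x g"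
proof -
  let ?A = "Poly_Mapping.keys f \<union> Poly_Mapping.keys g"
  have "Poly_Mapping.keys (f + g) \<subseteq> ?A" by (rule Poly_Mapping.keys_add)
  then show ?thesis
    by (simp add: dpoly_eval_superset[of ?A] lookup_add const_seq_simps distrib_right sum.distrib)
qed

lemma dpoly_eval_single: "dpoly_eval x (Poly_Mapping.single m a) = const_seq a * dmonom_eval x m"
  by (subst dpoly_eval_superset[of "{m}"]) auto

lemma dpoly_eval_mult: "dpoly_eval x (f * g) = dpoly_eval x f * dpoly_eval x g"
proof (induction f rule: pm_induct)
  case (add f m a)
  have "dpoly_eval x (Poly_Mapping.single m a * g) =
      dpoly_eval x (Poly_Mapping.single m a) * dpoly_eval x g"
  proof (induction g rule: pm_induct)
    case (add g m' b)
    then show ?case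
      by (simp add: distrib_left mult_single dpoly_eval_add dpoly_eval_single dmonom_eval_add
          const_seq_simps mult_ac)
  qed simp
  with add show ?case by (simp add: distrib_right dpoly_eval_add)
qed simp

lemma dpoly_shift_superset:
  assumes "finite A" "Poly_Mapping.keys f \<subseteq> A"
  shows "dpoly_shift f = (\<Sum>m\<in>A. Poly_Mapping.single (dmonom_shift m) (Poly_Mapping.lookup f m))"
  unfolding dpoly_shift_def
  by (rule sum.mono_neutral_left) (use assms in \<open>auto simp: in_keys_iff\<close>)

lemma dpoly_shift_0 [simp]: "dpoly_shift 0 = 0"
  by (simp add: dpoly_shift_def)

lemma dpoly_shift_add: "dpoly_shift (f + g) = dpoly_shift f + dpoly_shift g"
proof -
  let ?A = "Poly_Mapping.keys f \<union> Poly_Mapping.keys g"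
  have "Poly_Mapping.keys (f + g) \<subseteq> ?A" by (rule Poly_Mapping.keys_add)
  then show ?thesis
    by (simp add: dpoly_shift_superset[of ?A] lookup_add single_add sum.distrib)
qed

lemma dpoly_shift_single:
  "dpoly_shift (Poly_Mapping.single m a) = Poly_Mapping.single (dmonom_shift m) a"
  by (subst dpoly_shift_superset[of "{m}"]) auto

lemma dpoly_shift_mult: "dpoly_shift (f * g) = dpoly_shift f * dpoly_shift g"
proof (induction f rule: pm_induct)
  case (add f m a)
  have "dpoly_shift (Poly_Mapping.single m a * g) =
      dpoly_shift (Poly_Mapping.single m a) * dpoly_shift g"
  proof (induction g rule: pm_induct)
    case (add g m' b)
    then show ?case
      by (simp add: distrib_left mult_single dpoly_shift_add dpoly_shift_single dmonom_shift_add)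
  qed simp
  with add show ?case by (simp add: distrib_right dpoly_shift_add)
qed simp

lemma dpoly_shift_endomorphism:
  shows "dpoly_shift (f + g) = dpoly_shift f + dpoly_shift g"
    and "dpoly_shift (f * g) = dpoly_shift f * dpoly_shift g"
    and "dpoly_shift (dconst a) = dconst a"
    and "dpoly_shift (dvar i j) = dvar i (Suc j)"
  by (simp_all add: dpoly_shift_add dpoly_shift_mult dpoly_shift_single dmonom_shift_single
      dconst_def dvar_def)

lemma dpoly_eval_morphism:
  fixes x :: "nat \<Rightarrow> 'm::semiring_1 \<Rightarrow> 'a::field"
  shows "dpoly_eval x (f + g) = dpoly_eval x f + dpoly_eval x g"
    and "dpoly_eval x (f * g) = dpoly_eval x f * dpoly_eval x g"
    and "dpoly_eval x (dconst a) = const_seq a"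
    and "dpoly_eval x (dpoly_shift f) = seq_shift (dpoly_eval x f)"
    and "dpoly_eval x (dvar i 0) = x i"
proof -
  show "dpoly_eval x (dpoly_shift f) = seq_shift (dpoly_eval x f)"
  proof (induction f rule: pm_induct)
    case (add f m a)
    then show ?case
      by (simp add: dpoly_eval_add dpoly_shift_add dpoly_shift_single dpoly_eval_single
          dmonom_eval_shift seq_shift_simps del: plus_fun_apply times_fun_apply)
  qed (simp add: seq_shift_simps del: zero_fun_apply)
qed (simp_all add: dpoly_eval_add dpoly_eval_mult dpoly_eval_single dmonom_eval_single
    dconst_def dvar_def const_seq_simps)

lemma dpoly_eval_unique:
  fixes x :: "nat \<Rightarrow> 'm::semiring_1 \<Rightarrow> 'a::field" and \<phi> :: "'a dpoly \<Rightarrow> 'm \<Rightarrow> 'a"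
  assumes K: "is_subfield K"
    and add: "\<And>f g. f \<in> dpolys K n \<Longrightarrow> g \<in> dpolys K n \<Longrightarrow> \<phi> (f + g) = \<phi> f + \<phi> g"
    and mult: "\<And>f g. f \<in> dpolys K n \<Longrightarrow> g \<in> dpolys K n \<Longrightarrow> \<phi> (f * g) = \<phi> f * \<phi> g"
    and const: "\<And>a. a \<in> K \<Longrightarrow> \<phi> (dconst a) = const_seq a"
    and shift: "\<And>f. f \<in> dpolys K n \<Longrightarrow> \<phi> (dpoly_shift f) = seq_shift (\<phi> f)"
    and var: "\<And>i. i < n \<Longrightarrow> \<phi> (dvar i 0) = x i"
    and f: "f \<in> dpolys K n"
  shows "\<phi> f = dpoly_eval x f"
proof -
  have K0: "0 \<in> K" and K1: "1 \<in> K" using K by (auto simp: is_subfield_def)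
  have single_in: "Poly_Mapping.single m a \<in> dpolys K n"
    if "a \<in> K" "\<forall>v\<in>Poly_Mapping.keys m. fst v < n" for m a
    using that K0 by (auto simp: dpolys_def lookup_single when_def split: if_splits)
  have var': "\<phi> (dvar i j) = (seq_shift ^^ j) (x i)" if "i < n" for i j
  proof (induction j)
    case (Suc j)
    have "dvar i j \<in> dpolys K n" unfolding dvar_def
      by (rule single_in) (use that K1 in auto)
    from shift[OF this] Suc show ?case by (simp add: dpoly_shift_endomorphism)
  qed (simp add: var that)
  have one: "\<phi> 1 = 1"
    using const[OF K1] by (simp add: dconst_def const_seq_simps)
  have pow: "\<phi> (Poly_Mapping.single (Poly_Mapping.single v e) 1) =
      dmonom_eval x (Poly_Mapping.single v e)" if v: "fst v < n" for v and e :: nat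
  proof (induction e)
    case (Suc e)
    obtain i j where ij: "v = (i, j)" by (cases v)
    have "Poly_Mapping.single (Poly_Mapping.single v (Suc e)) (1::'a) =
        dvar i j * Poly_Mapping.single (Poly_Mapping.single v e) 1"
      by (simp add: dvar_def mult_single ij flip: single_add)
    moreover have "dvar i j \<in> dpolys K n" unfolding dvar_def
      by (rule single_in) (use v K1 ij in auto)
    moreover have "Poly_Mapping.single (Poly_Mapping.single v e) 1 \<in> dpolys K n"
      by (rule single_in) (use v K1 in auto)
    ultimately show ?case using Suc v ij
      by (simp add: mult var' dmonom_eval_single)
  qed (simp add: one)
  have mon: "\<phi> (Poly_Mapping.single m 1) = dmonom_eval x m"
    if "\<forall>v\<in>Poly_Mapping.keys m. fst v < n" for m
    using that
  proof (induction m rule: pm_induct)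
    case (add m v e)
    from add.prems have m: "\<forall>v\<in>Poly_Mapping.keys m. fst v < n" and v: "fst v < n"
      by (auto simp: keys_add_single[OF add.hyps])
    have "Poly_Mapping.single (m + Poly_Mapping.single v e) (1::'a) =
        Poly_Mapping.single m 1 * Poly_Mapping.single (Poly_Mapping.single v e) 1"
      by (simp add: mult_single)
    moreover have "Poly_Mapping.single m 1 \<in> dpolys K n" using single_in K1 m by blast
    moreover have "Poly_Mapping.single (Poly_Mapping.single v e) 1 \<in> dpolys K n"
      by (rule single_in) (use v K1 in auto)
    ultimately show ?case using add.IH m v
      by (simp add: mult pow dmonom_eval_add)
  qed (simp add: one)
  show ?thesis using f
  proof (induction f rule: pm_induct)
    case zero
    then show ?case using const[OF K0] by (simp add: dconst_def const_seq_simps)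
  next
    case (add f m a)
    have la: "Poly_Mapping.lookup f m = 0" using add.hyps by (simp add: in_keys_iff)
    have "Poly_Mapping.lookup (f + Poly_Mapping.single m a) m \<in> K"
      using add.prems unfolding dpolys_def by blast
    then have a: "a \<in> K" by (simp add: lookup_add la)
    have m: "\<forall>v\<in>Poly_Mapping.keys m. fst v < n"
      using add.prems keys_add_single[OF add.hyps] by (auto simp: dpolys_def)
    have "Poly_Mapping.lookup f m' \<in> K" for m'
    proof (cases "m' = m")
      case False
      then have "Poly_Mapping.lookup f m' = Poly_Mapping.lookup (f + Poly_Mapping.single m a) m'"
        by (simp add: lookup_add lookup_single)
      then show ?thesis using add.prems unfolding dpolys_def by auto
    qed (simp add: la K0)
    then have fin: "f \<in> dpolys K n"
      using add.prems keys_add_single[OF add.hyps] by (auto simp: dpolys_def)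
    have "Poly_Mapping.single m a = dconst a * Poly_Mapping.single m 1"
      by (simp add: dconst_def mult_single)
    moreover have "dconst a \<in> dpolys K n" unfolding dconst_def
      by (rule single_in) (use a in auto)
    moreover have "Poly_Mapping.single m 1 \<in> dpolys K n" using single_in K1 m by blast
    ultimately have "\<phi> (Poly_Mapping.single m a) = const_seq a * dmonom_eval x m"
      using mult const[OF a] mon[OF m] by simp
    then show ?case
      using assms(2)[OF fin single_in[OF a m]] add.IH[OF fin]
      by (simp add: dpoly_eval_add dpoly_eval_single)
  qed
qed


section \<open>The decision problem\<close>

text \<open>
  An \<open>n\<close>-tuple of sequences is an extensional function on \<open>{..<n}\<close>.  The type argument selects
  the index set of the sequences.
\<close>

definition holds_for_all_solutions ::
    "'m::semiring_1 itself \<Rightarrow> nat \<Rightarrow> 'a::field dpoly set \<Rightarrow> 'a dpoly \<Rightarrow> bool" where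
  "holds_for_all_solutions _ n F g \<longleftrightarrow>
     (\<forall>x \<in> {..<n} \<rightarrow>\<^sub>E (UNIV :: ('m \<Rightarrow> 'a) set).
        (\<forall>f\<in>F. dpoly_eval x f = 0) \<longrightarrow> dpoly_eval x g = 0)"

text \<open>
  A natural number codes a list of indeterminates, whose product is a monomial; a list of pairs of
  a coefficient name and a monomial code, whose sum is a difference polynomial; and a triple of
  the number of unknowns, the list of left-hand sides of \<open>F = 0\<close>, and the left-hand side of
  \<open>g = 0\<close>.
\<close>

definition decode_dmonom :: "nat \<Rightarrow> dmonom" where
  "decode_dmonom c = (\<Sum>v\<leftarrow>list_decode c. Poly_Mapping.single (prod_decode v) 1)"

definition decode_dpoly :: "(nat \<Rightarrow> 'a::field) \<Rightarrow> nat \<Rightarrow> 'a dpoly" where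
  "decode_dpoly \<nu> c = (\<Sum>t\<leftarrow>list_decode c.
     case prod_decode t of (a, m) \<Rightarrow> Poly_Mapping.single (decode_dmonom m) (\<nu> a))"

definition decode_instance ::
    "(nat \<Rightarrow> 'a::field) \<Rightarrow> nat \<Rightarrow> nat \<times> 'a dpoly set \<times> 'a dpoly" where
  "decode_instance \<nu> e = (case prod_decode e of (n, c) \<Rightarrow> case prod_decode c of (s, t) \<Rightarrow>
     (n, decode_dpoly \<nu> ` set (list_decode s), decode_dpoly \<nu> t))"

text \<open>
  An algorithm has to halt with the correct answer, \<open>1\<close> for yes and \<open>0\<close> for no, on every code of
  an instance; nothing is required on other inputs.
\<close>

definition consequence_problem_decidable ::
    "'m::semiring_1 itself \<Rightarrow> 'a::field set \<Rightarrow> (nat \<Rightarrow> 'a) \<Rightarrow> bool" where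
  "consequence_problem_decidable M K \<nu> \<longleftrightarrow>
     (\<exists>p. \<forall>e n F g. decode_instance \<nu> e = (n, F, g) \<and> F \<subseteq> dpolys K n \<and> g \<in> dpolys K n \<longrightarrow>
        recf_result p [e] (if holds_for_all_solutions M n F g then 1 else 0))"

lemma decode_dmonom_surj: "\<exists>c. decode_dmonom c = m"
proof (induction m rule: pm_induct)
  case zero
  have "decode_dmonom (list_encode []) = 0"
    unfolding decode_dmonom_def list_encode_inverse by simp
  then show ?case by blast
next
  case (add m v e)
  then obtain c where c: "decode_dmonom c = m" by blast
  let ?c = "list_encode (replicate e (prod_encode v) @ list_decode c)"
  have "(\<Sum>v\<leftarrow>replicate e (prod_encode v). Poly_Mapping.single (prod_decode v) (1::nat)) =
      Poly_Mapping.single v e"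
    by (induction e) (simp_all flip: single_add)
  then have "decode_dmonom ?c = m + Poly_Mapping.single v e"
    using c unfolding decode_dmonom_def list_encode_inverse by (simp add: add.commute)
  then show ?case by blast
qed

lemma decode_dpoly_surj:
  assumes \<nu>: "range \<nu> = K" and f: "f \<in> dpolys K n"
  shows "\<exists>c. decode_dpoly \<nu> c = f"
proof -
  have "\<exists>c. decode_dpoly \<nu> c = f"
    if "\<And>m. m \<in> Poly_Mapping.keys f \<Longrightarrow> Poly_Mapping.lookup f m \<in> K" for f
    using that
  proof (induction f rule: pm_induct)
    case zero
    have "decode_dpoly \<nu> (list_encode []) = 0"
      unfolding decode_dpoly_def list_encode_inverse by simp
    then show ?case by blast
  next
    case (add f m a)
    have la: "Poly_Mapping.lookup f m = 0" using add.hyps by (simp add: in_keys_iff)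
    have "a \<in> K" using add.prems[of m] add.hyps by (simp add: keys_add_single lookup_add la)
    then obtain b where b: "\<nu> b = a" using \<nu> by blast
    have "Poly_Mapping.lookup f m' \<in> K" if "m' \<in> Poly_Mapping.keys f" for m'
      using add.prems[of m'] that add.hyps
      by (cases "m' = m") (simp_all add: keys_add_single lookup_add lookup_single)
    with add.IH obtain c where c: "decode_dpoly \<nu> c = f" by blast
    obtain d where d: "decode_dmonom d = m" using decode_dmonom_surj by blast
    have "decode_dpoly \<nu> (list_encode (prod_encode (b, d) # list_decode c)) =
        f + Poly_Mapping.single m a"
      using c b d unfolding decode_dpoly_def list_encode_inverse by (simp add: add.commute)
    then show ?case by blast
  qed
  with f show ?thesis by (auto simp: dpolys_def)
qed

lemma decode_instance_surj:
  assumes \<nu>: "range \<nu> = K" and F: "finite F" "F \<subseteq> dpolys K n" and g: "g \<in> dpolys K n"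
  shows "\<exists>e. decode_instance \<nu> e = (n, F, g)"
proof -
  obtain fs where fs: "set fs = F" using finite_list[OF F(1)] by blast
  have "\<forall>f\<in>F. \<exists>c. decode_dpoly \<nu> c = f" using decode_dpoly_surj[OF \<nu>] F(2) by blast
  then obtain C where C: "\<And>f. f \<in> F \<Longrightarrow> decode_dpoly \<nu> (C f) = f" by metis
  obtain t where t: "decode_dpoly \<nu> t = g" using decode_dpoly_surj[OF \<nu> g] by blast
  have "decode_dpoly \<nu> ` set (map C fs) = F" using C fs by force
  with t have "decode_instance \<nu> (prod_encode (n, prod_encode (list_encode (map C fs), t))) =
      (n, F, g)"
    unfolding decode_instance_def by (simp add: list_encode_inverse del: list_encode.simps)
  then show ?thesis by blast
qed

end

(*
  A partial recursive function is run as a counter program, and one step of a counter program is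
  a system of difference equations: zero tests are expressible over a field, because s = s s y
  forces s y to be 0 or 1 according to whether s = 0.  Thus there is a solution that starts a run
  on input a, and stays consistent, if and only if the function has value 1 at a.

  A decision procedure p for the consequence problem is refuted by diagonalization.  The input is
  itself the code s of a system: adding the single equation "the run starts with input s" is
  computable on codes, and applying this to the system that runs p on the result gives an instance
  on which p answers yes if and only if the instance has a solution with g not zero, that is, if
  and only if the correct answer is no.
*)
theory Submission
  imports Defs
begin

section \<open>Loop programs\<close>

datatype com =
    Assign nat "nat list" nat
  | Seq com com
  | Loop nat com

text \<open>The loop decrements its register before each pass, but the body may write that register
  again. So one construct serves both counted recursion and unbounded search.\<close>

inductive big_step :: "com \<Rightarrow> (nat \<Rightarrow> nat) \<Rightarrow> (nat \<Rightarrow> nat) \<Rightarrow> bool" where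
  Assign: "big_step (Assign d rs c) s (s(d := sum_list (map s rs) + c))"
| Seq: "big_step c1 s s1 \<Longrightarrow> big_step c2 s1 s2 \<Longrightarrow> big_step (Seq c1 c2) s s2"
| Loop_0: "s r = 0 \<Longrightarrow> big_step (Loop r c) s s"
| Loop_Suc: "s r \<noteq> 0 \<Longrightarrow> big_step c (s(r := s r - 1)) s1 \<Longrightarrow> big_step (Loop r c) s1 s2 \<Longrightarrow>
    big_step (Loop r c) s s2"

lemma big_step_AssignI: "s' = s(d := sum_list (map s rs) + c) \<Longrightarrow> big_step (Assign d rs c) s s'"
  by (simp add: big_step.Assign)

text \<open>The list holds compiled commands that still await target and scratch base. The
  assignment for the empty list stands in for a no-op: it clears the register after the last target,
  hence the scratch base \<open>k + m + 1\<close> in \<open>com_of\<close>.\<close>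

primrec seq_coms :: "(nat \<Rightarrow> nat \<Rightarrow> com) list \<Rightarrow> nat \<Rightarrow> nat \<Rightarrow> com" where
  "seq_coms [] t k = Assign t [] 0"
| "seq_coms (f # fs) t k = Seq (f t k) (seq_coms fs (Suc t) k)"

text \<open>
  The command \<open>com_of p args tgt k\<close> reads its arguments in the registers \<open>args\<close>, leaves the value
  in \<open>tgt\<close>, and uses the registers from \<open>k\<close> on as scratch space.
\<close>

primrec com_of :: "recf \<Rightarrow> nat list \<Rightarrow> nat \<Rightarrow> nat \<Rightarrow> com" where
  "com_of Zero = (\<lambda>args tgt k. Assign tgt [] 0)"
| "com_of Succ = (\<lambda>args tgt k. Assign tgt [hd args] 1)"
| "com_of (Proj i) = (\<lambda>args tgt k. Assign tgt [args ! i] 0)"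
| "com_of (Comp p qs) = (\<lambda>args tgt k.
    let m = length qs in
    Seq (seq_coms (map (\<lambda>f. f args) (map com_of qs)) k (k + m + 1))
      (com_of p [k..<k + m] tgt (k + m + 1)))"
| "com_of (PrimRec p q) = (\<lambda>args tgt k.
    Seq (Assign k [hd args] 0) (Seq (Assign (k + 1) [] 0) (Seq (com_of p (tl args) (k + 2) (k + 3))
      (Seq (Loop k (Seq (com_of q ((k + 1) # (k + 2) # tl args) (k + 2) (k + 3))
              (Assign (k + 1) [k + 1] 1)))
        (Assign tgt [k + 2] 0)))))"
| "com_of (Mu p) = (\<lambda>args tgt k.
    Seq (Assign k [] 0) (Seq (com_of p (k # args) (k + 1) (k + 2))
      (Seq (Loop (k + 1) (Seq (Assign k [k] 1) (com_of p (k # args) (k + 1) (k + 2))))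
        (Assign tgt [k] 0))))"

text \<open>Nothing is claimed where \<open>p\<close> is undefined. The target may be one of the
  argument registers, as happens in the loop for \<open>PrimRec\<close>; the frame condition lets
  later commands read the other arguments again.\<close>

definition implements :: "(nat list \<Rightarrow> nat \<Rightarrow> nat \<Rightarrow> com) \<Rightarrow> recf \<Rightarrow> bool" where
  "implements f p \<longleftrightarrow> (\<forall>s args tgt k y. recf_result p (map s args) y \<longrightarrow> set args \<subseteq> {..<k} \<longrightarrow>
     tgt < k \<longrightarrow> (\<exists>s'. big_step (f args tgt k) s s' \<and> s' tgt = y \<and> (\<forall>r<k. r \<noteq> tgt \<longrightarrow> s' r = s r)))"

lemma implementsD:
  assumes "implements f p" "recf_result p xs y" "map s args = xs" "set args \<subseteq> {..<k}" "tgt < k"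
  obtains s' where "big_step (f args tgt k) s s'" "s' tgt = y" "\<And>r. r < k \<Longrightarrow> r \<noteq> tgt \<Longrightarrow> s' r = s r"
  using assms unfolding implements_def by metis

text \<open>The arguments lie below all targets, so every command reads the original values; a
  stored value lies below the later targets and survives.\<close>

lemma seq_coms_correct:
  assumes "list_all2 (\<lambda>q y. recf_result q (map s args) y) qs ys"
    and "\<forall>q\<in>set qs. implements (com_of q) q"
    and "set args \<subseteq> {..<k}" "k \<le> t" "t + length qs < K"
  shows "\<exists>s'. big_step (seq_coms (map (\<lambda>f. f args) (map com_of qs)) t K) s s' \<and>
    map s' [t..<t + length qs] = ys \<and> (\<forall>r<t. s' r = s r)"
  using assms
proof (induction qs arbitrary: ys s t)
  case Nil
  then show ?case by (auto intro!: exI[of _ "s(t := 0)"] big_step_AssignI)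
next
  case (Cons q qs zs)
  from Cons.prems(1) obtain y ys where zs: "zs = y # ys" "recf_result q (map s args) y"
    "list_all2 (\<lambda>q y. recf_result q (map s args) y) qs ys"
    by (auto simp: list_all2_Cons1)
  obtain s1 where s1: "big_step (com_of q args t K) s s1" "s1 t = y"
    "\<And>r. r < K \<Longrightarrow> r \<noteq> t \<Longrightarrow> s1 r = s r"
    by (rule implementsD[of "com_of q" q "map s args" y s args K t])
      (use Cons.prems zs(2) in auto)
  have eq: "map s1 args = map s args"
    using Cons.prems s1(3) by (auto simp: subset_eq)
  have "\<exists>s'. big_step (seq_coms (map (\<lambda>f. f args) (map com_of qs)) (Suc t) K) s1 s' \<and>
    map s' [Suc t..<Suc t + length qs] = ys \<and> (\<forall>r<Suc t. s' r = s1 r)"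
    by (rule Cons.IH, unfold eq) (use Cons.prems zs(3) in auto)
  then obtain s2 where s2: "big_step (seq_coms (map (\<lambda>f. f args) (map com_of qs)) (Suc t) K) s1 s2"
    "map s2 [Suc t..<Suc t + length qs] = ys" "\<forall>r<Suc t. s2 r = s1 r" by blast
  have "map s2 [t..<t + length (q # qs)] = y # ys"
    using s2 s1(2) by (simp add: upt_conv_Cons del: upt_Suc)
  with s1 s2 Cons.prems zs(1) show ?case
    by (auto intro!: exI[of _ s2] big_step.Seq[OF s1(1)])
qed

text \<open>Derivations unfold the recursion downwards, whereas a loop computes upwards; the table
  \<open>v\<close> of intermediate values mediates.\<close>

lemma PrimRec_trace:
  assumes "recf_result (PrimRec p q) (n # xs) y"
  obtains v where "recf_result p xs (v 0)" "v n = y"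
    "\<And>i. i < n \<Longrightarrow> recf_result q (i # v i # xs) (v (Suc i))"
proof -
  have "\<exists>v. recf_result p xs (v 0) \<and> v n = y \<and> (\<forall>i<n. recf_result q (i # v i # xs) (v (Suc i)))"
    using assms
  proof (induction n arbitrary: y)
    case 0
    then show ?case by (auto elim: recf_result.cases intro!: exI[of _ "\<lambda>_. y"])
  next
    case (Suc n)
    from Suc.prems obtain r where r: "recf_result (PrimRec p q) (n # xs) r"
      "recf_result q (n # r # xs) y"
      by (auto elim: recf_result.cases)
    from Suc.IH[OF r(1)] obtain v where v: "recf_result p xs (v 0)" "v n = r"
      "\<forall>i<n. recf_result q (i # v i # xs) (v (Suc i))"
      by blast
    show ?case
      by (rule exI[of _ "v(Suc n := y)"]) (use v r in \<open>auto simp: less_Suc_eq\<close>)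
  qed
  with that show ?thesis by blast
qed

text \<open>Register \<open>k\<close> counts the remaining passes, \<open>k + 1\<close> holds the
  recursion index and \<open>k + 2\<close> the value reached so far.\<close>

lemma implements_PrimRec:
  assumes p: "implements (com_of p) p" and q: "implements (com_of q) q"
  shows "implements (com_of (PrimRec p q)) (PrimRec p q)"
  unfolding implements_def
proof (intro allI impI)
  fix s :: "nat \<Rightarrow> nat" and args tgt k y
  assume res: "recf_result (PrimRec p q) (map s args) y" and args: "set args \<subseteq> {..<k}" and "tgt < k"
  from res obtain a as where as: "args = a # as"
    by (cases args) (auto elim: recf_result.cases)
  define n where "n = s a"
  obtain v where v: "recf_result p (map s as) (v 0)" "v n = y"
    "\<And>i. i < n \<Longrightarrow> recf_result q (i # v i # map s as) (v (Suc i))"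
    using PrimRec_trace[of p q n "map s as" y] res as n_def by auto
  define body where "body = Seq (com_of q ((k + 1) # (k + 2) # as) (k + 2) (k + 3))
    (Assign (k + 1) [k + 1] 1)"
  \<comment> \<open>Loop invariant with \<open>m\<close> passes left: the index is
    \<open>n - m\<close> and the value is \<open>v (n - m)\<close>.\<close>
  have loop: "\<exists>s'. big_step (Loop k body) t s' \<and> s' (k + 2) = y \<and> (\<forall>r<k. s' r = s r)"
    if "t k = m" "t (k + 1) = n - m" "t (k + 2) = v (n - m)" "m \<le> n" "\<forall>r<k. t r = s r" for t m
    using that
  proof (induction m arbitrary: t)
    case 0
    then show ?case using v(2) by (auto intro: big_step.Loop_0)
  next
    case (Suc m)
    let ?t = "t(k := t k - 1)"
    have args': "map ?t ((k + 1) # (k + 2) # as) = (n - Suc m) # v (n - Suc m) # map s as"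
      using Suc.prems args as by auto
    have resq: "recf_result q ((n - Suc m) # v (n - Suc m) # map s as) (v (n - m))"
      using v(3)[of "n - Suc m"] Suc.prems by (simp add: Suc_diff_Suc)
    obtain t1 where t1: "big_step (com_of q ((k + 1) # (k + 2) # as) (k + 2) (k + 3)) ?t t1"
      "t1 (k + 2) = v (n - m)" "\<And>r. r < k + 3 \<Longrightarrow> r \<noteq> k + 2 \<Longrightarrow> t1 r = ?t r"
      by (rule implementsD[OF q resq args', where k = "k + 3" and tgt = "k + 2"])
        (use args as in auto)
    let ?t2 = "t1(k + 1 := t1 (k + 1) + 1)"
    have "\<exists>s'. big_step (Loop k body) ?t2 s' \<and> s' (k + 2) = y \<and> (\<forall>r<k. s' r = s r)"
      by (rule Suc.IH) (use Suc.prems t1 in auto)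
    moreover have "big_step body ?t ?t2"
      unfolding body_def by (rule big_step.Seq[OF t1(1)]) (auto intro: big_step_AssignI)
    ultimately show ?case
      using Suc.prems(1) by (metis big_step.Loop_Suc nat.distinct(1))
  qed
  let ?s1 = "s(k := n, k + 1 := 0)"
  obtain s2 where s2: "big_step (com_of p as (k + 2) (k + 3)) ?s1 s2"
      "s2 (k + 2) = v 0" "\<And>r. r < k + 3 \<Longrightarrow> r \<noteq> k + 2 \<Longrightarrow> s2 r = ?s1 r"
    by (rule implementsD[OF p v(1), where s = ?s1 and args = as
          and k = "k + 3" and tgt = "k + 2"])
      (use args as in auto)
  have "\<exists>s'. big_step (Loop k body) s2 s' \<and> s' (k + 2) = y \<and> (\<forall>r<k. s' r = s r)"
    by (rule loop[of _ n]) (use s2 in auto)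
  then obtain s3 where s3: "big_step (Loop k body) s2 s3" "s3 (k + 2) = y" "\<forall>r<k. s3 r = s r"
    by blast
  have "big_step (com_of (PrimRec p q) args tgt k) s (s3(tgt := y))"
    unfolding as com_of.simps list.sel body_def[symmetric]
    by (rule big_step.Seq[where ?s1.0 = "s(k := n)"], simp add: big_step_AssignI n_def,
        rule big_step.Seq[where ?s1.0 = ?s1], simp add: big_step_AssignI,
        rule big_step.Seq[OF s2(1)], rule big_step.Seq[OF s3(1)])
      (use s3(2) in \<open>auto intro!: big_step_AssignI\<close>)
  with s3 show "\<exists>s'. big_step (com_of (PrimRec p q) args tgt k) s s' \<and> s' tgt = y \<and>
      (\<forall>r<k. r \<noteq> tgt \<longrightarrow> s' r = s r)"
    by (auto intro!: exI[of _ "s3(tgt := y)"])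
qed

text \<open>Register \<open>k\<close> holds the candidate and \<open>k + 1\<close> the value of
  \<open>p\<close> there. The decrement of \<open>k + 1\<close> by the loop does no harm, since the
  body recomputes the value for the next candidate.\<close>

lemma implements_Mu:
  assumes p: "implements (com_of p) p"
  shows "implements (com_of (Mu p)) (Mu p)"
  unfolding implements_def
proof (intro allI impI)
  fix s :: "nat \<Rightarrow> nat" and args tgt k n
  assume res: "recf_result (Mu p) (map s args) n" and args: "set args \<subseteq> {..<k}" and "tgt < k"
  have "recf_result p (n # map s args) 0" "\<forall>m<n. \<exists>y>0. recf_result p (m # map s args) y"
    using res by (auto elim: recf_result.cases)
  then have "\<forall>m. \<exists>y. m \<le> n \<longrightarrow> recf_result p (m # map s args) y \<and> (y = 0 \<longleftrightarrow> m = n)"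
    by (metis le_neq_implies_less less_irrefl)
  then obtain v where v: "\<And>m. m \<le> n \<Longrightarrow> recf_result p (m # map s args) (v m)"
    "\<And>m. m \<le> n \<Longrightarrow> v m = 0 \<longleftrightarrow> m = n"
    by metis
  have eval: "\<exists>t1. big_step (com_of p (k # args) (k + 1) (k + 2)) t t1 \<and> t1 k = t k \<and>
      t1 (k + 1) = v (t k) \<and> (\<forall>r<k. t1 r = s r)"
    if "t k \<le> n" "\<forall>r<k. t r = s r" for t
  proof -
    have "map t (k # args) = t k # map s args" using that args by auto
    with v(1)[OF that(1)] show ?thesis
      by (rule implementsD[OF p, where k = "k + 2" and tgt = "k + 1"])
        (use args that(2) in auto)
  qed
  define body where "body = Seq (Assign k [k] 1) (com_of p (k # args) (k + 1) (k + 2))"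
  \<comment> \<open>Induction on the distance from the candidate to \<open>n\<close>; the loop
    continues before \<open>n\<close> because \<open>v\<close> vanishes only there.\<close>
  have loop: "\<exists>s'. big_step (Loop (k + 1) body) t s' \<and> s' k = n \<and> (\<forall>r<k. s' r = s r)"
    if "n - t k = m" "t k \<le> n" "t (k + 1) = v (t k)" "\<forall>r<k. t r = s r" for t m
    using that
  proof (induction m arbitrary: t)
    case 0
    then show ?case using v(2)[of n] by (auto intro: big_step.Loop_0)
  next
    case (Suc m)
    then have le: "Suc (t k) \<le> n" and nz: "t (k + 1) \<noteq> 0" using v(2)[of "t k"] by auto
    let ?t = "t(k + 1 := t (k + 1) - 1)"
    let ?t1 = "?t(k := Suc (t k))"
    obtain t2 where t2: "big_step (com_of p (k # args) (k + 1) (k + 2)) ?t1 t2"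
      "t2 k = Suc (t k)" "t2 (k + 1) = v (Suc (t k))" "\<forall>r<k. t2 r = s r"
      using eval[of ?t1] le Suc.prems by auto
    have "\<exists>s'. big_step (Loop (k + 1) body) t2 s' \<and> s' k = n \<and> (\<forall>r<k. s' r = s r)"
      by (rule Suc.IH) (use Suc.prems le t2 in auto)
    moreover have "big_step body ?t t2"
      unfolding body_def by (rule big_step.Seq[OF _ t2(1)]) (auto intro: big_step_AssignI)
    ultimately show ?case
      using nz by (metis big_step.Loop_Suc)
  qed
  obtain s1 where s1: "big_step (com_of p (k # args) (k + 1) (k + 2)) (s(k := 0)) s1"
      "s1 k = 0" "s1 (k + 1) = v 0" "\<forall>r<k. s1 r = s r"
    using eval[of "s(k := 0)"] by auto
  have "\<exists>s'. big_step (Loop (k + 1) body) s1 s' \<and> s' k = n \<and> (\<forall>r<k. s' r = s r)"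
    by (rule loop[of _ n]) (use s1 in auto)
  then obtain s2 where s2: "big_step (Loop (k + 1) body) s1 s2" "s2 k = n" "\<forall>r<k. s2 r = s r"
    by blast
  have "big_step (com_of (Mu p) args tgt k) s (s2(tgt := n))"
    unfolding com_of.simps body_def[symmetric]
    by (rule big_step.Seq[where ?s1.0 = "s(k := 0)"], simp add: big_step_AssignI,
        rule big_step.Seq[OF s1(1)], rule big_step.Seq[OF s2(1)])
      (use s2(2) in \<open>auto intro!: big_step_AssignI\<close>)
  with s2 show "\<exists>s'. big_step (com_of (Mu p) args tgt k) s s' \<and> s' tgt = n \<and>
      (\<forall>r<k. r \<noteq> tgt \<longrightarrow> s' r = s r)"
    by (auto intro!: exI[of _ "s2(tgt := n)"])
qed

lemma implements_Comp:
  assumes p: "implements (com_of p) p" and qs: "\<forall>q\<in>set qs. implements (com_of q) q"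
  shows "implements (com_of (Comp p qs)) (Comp p qs)"
  unfolding implements_def
proof (intro allI impI)
  fix s :: "nat \<Rightarrow> nat" and args tgt k y
  assume res: "recf_result (Comp p qs) (map s args) y" and args: "set args \<subseteq> {..<k}" and tgt: "tgt < k"
  obtain ys where ys: "list_all2 (\<lambda>q y. recf_result q (map s args) y) qs ys" "recf_result p ys y"
    using res by (auto elim: recf_result.cases)
  let ?m = "length qs"
  let ?K = "k + ?m + 1"
  obtain s1 where s1: "big_step (seq_coms (map (\<lambda>f. f args) (map com_of qs)) k ?K) s s1"
    "map s1 [k..<k + ?m] = ys" "\<forall>r<k. s1 r = s r"
    using seq_coms_correct[OF ys(1) qs args, of k ?K] by auto
  obtain s2 where s2: "big_step (com_of p [k..<k + ?m] tgt ?K) s1 s2" "s2 tgt = y"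
    "\<And>r. r < ?K \<Longrightarrow> r \<noteq> tgt \<Longrightarrow> s2 r = s1 r"
    by (rule implementsD[OF p ys(2) s1(2), of ?K tgt]) (use tgt in auto)
  have "big_step (com_of (Comp p qs) args tgt k) s s2"
    by (simp add: Let_def) (use s1(1) s2(1) in \<open>auto intro!: big_step.Seq\<close>)
  with s1 s2 show "\<exists>s'. big_step (com_of (Comp p qs) args tgt k) s s' \<and> s' tgt = y \<and>
      (\<forall>r<k. r \<noteq> tgt \<longrightarrow> s' r = s r)"
    by (auto intro!: exI[of _ s2])
qed

lemma implements_Assign:
  assumes "\<And>s args y. recf_result p (map s args) y \<Longrightarrow> y = sum_list (map s (rs args)) + c"
  shows "implements (\<lambda>args tgt k. Assign tgt (rs args) c) p"
  unfolding implements_def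
proof (intro allI impI)
  fix s :: "nat \<Rightarrow> nat" and args tgt k y
  assume "recf_result p (map s args) y"
  from assms[OF this] show "\<exists>s'. big_step (Assign tgt (rs args) c) s s' \<and> s' tgt = y \<and>
      (\<forall>r<k. r \<noteq> tgt \<longrightarrow> s' r = s r)"
    by (intro exI[of _ "s(tgt := y)"]) (auto intro: big_step_AssignI)
qed

lemma implements_com_of: "implements (com_of p) p"
proof (induction p)
  case Zero
  have "implements (\<lambda>args tgt k. Assign tgt [] 0) Zero"
    by (rule implements_Assign[where rs = "\<lambda>_. []"]) (auto elim: recf_result.cases)
  then show ?case by simp
next
  case Succ
  have "implements (\<lambda>args tgt k. Assign tgt [hd args] 1) Succ"
    by (rule implements_Assign[where rs = "\<lambda>args. [hd args]"]) (auto elim: recf_result.cases)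
  then show ?case by simp
next
  case (Proj i)
  have "implements (\<lambda>args tgt k. Assign tgt [args ! i] 0) (Proj i)"
    by (rule implements_Assign[where rs = "\<lambda>args. [args ! i]"]) (auto elim: recf_result.cases)
  then show ?case by simp
qed (simp_all add: implements_Comp implements_PrimRec implements_Mu del: com_of.simps)

section \<open>Flat programs\<close>

datatype instr =
    IAssign nat "nat list" nat
  | Dec nat nat
  | Jump nat

text \<open>Truncated subtraction leaves a zero register unchanged when \<open>Dec\<close>
  jumps.\<close>

fun exec :: "instr \<Rightarrow> nat \<times> (nat \<Rightarrow> nat) \<Rightarrow> nat \<times> (nat \<Rightarrow> nat)" where
  "exec (IAssign d rs c) (j, s) = (Suc j, s(d := sum_list (map s rs) + c))"
| "exec (Dec r l) (j, s) = (if s r = 0 then l else Suc j, s(r := s r - 1))"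
| "exec (Jump l) (j, s) = (l, s)"

text \<open>Configurations whose counter lies outside the program are fixed points, so halted runs
  can be iterated further.\<close>

definition step :: "instr list \<Rightarrow> nat \<times> (nat \<Rightarrow> nat) \<Rightarrow> nat \<times> (nat \<Rightarrow> nat)" where
  "step P c = (if fst c < length P then exec (P ! fst c) c else c)"

text \<open>Jump targets are absolute, hence the start address as second argument.\<close>

fun flatten :: "com \<Rightarrow> nat \<Rightarrow> instr list" where
  "flatten (Assign d rs c) a = [IAssign d rs c]"
| "flatten (Seq c1 c2) a = (let P = flatten c1 a in P @ flatten c2 (a + length P))"
| "flatten (Loop r c) a = (let P = flatten c (Suc a) in
     Dec r (a + length P + 2) # P @ [Jump a])"

definition code_at :: "instr list \<Rightarrow> nat \<Rightarrow> instr list \<Rightarrow> bool" where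
  "code_at P a is \<longleftrightarrow> (\<forall>i<length is. a + i < length P \<and> P ! (a + i) = is ! i)"

lemma code_at_Cons: "code_at P a (x # is) \<longleftrightarrow> a < length P \<and> P ! a = x \<and> code_at P (Suc a) is"
  by (auto simp: code_at_def less_Suc_eq_0_disj)

lemma code_at_append: "code_at P a (is @ js) \<longleftrightarrow> code_at P a is \<and> code_at P (a + length is) js"
  by (induction "is" arbitrary: a) (simp_all add: code_at_Cons, simp add: code_at_def)

lemma step_trans: "(step P ^^ m) c = c' \<Longrightarrow> (step P ^^ n) c' = c'' \<Longrightarrow> (step P ^^ (n + m)) c = c''"
  by (simp add: funpow_add)

lemma flatten_correct:
  assumes "big_step c s s'" "code_at P a (flatten c a)"
  shows "\<exists>t. (step P ^^ t) (a, s) = (a + length (flatten c a), s')"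
  using assms
proof (induction arbitrary: a rule: big_step.induct)
  case (Assign d rs c s)
  then show ?case by (intro exI[of _ 1]) (simp add: code_at_Cons step_def fun_upd_def)
next
  case (Seq c1 s s1 c2 s2)
  let ?a = "a + length (flatten c1 a)"
  have *: "code_at P a (flatten c1 a)" "code_at P ?a (flatten c2 ?a)"
    using Seq.prems by (auto simp: Let_def code_at_append)
  obtain t1 t2 where "(step P ^^ t1) (a, s) = (?a, s1)"
    "(step P ^^ t2) (?a, s1) = (?a + length (flatten c2 ?a), s2)"
    using Seq.IH(1)[OF *(1)] Seq.IH(2)[OF *(2)] by blast
  from step_trans[OF this] show ?case by (auto simp: Let_def add.assoc)
next
  case (Loop_0 s r c)
  then have "step P (a, s) = (a + length (flatten c (Suc a)) + 2, s(r := 0))"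
    by (simp add: Let_def code_at_Cons step_def)
  then show ?case using Loop_0(1)
    by (intro exI[of _ 1]) (simp add: Let_def fun_upd_idem)
next
  case (Loop_Suc s r c s1 s2)
  let ?P = "flatten c (Suc a)"
  have *: "step P (a, s) = (Suc a, s(r := s r - 1))" 
    "step P (Suc a + length ?P, s1) = (a, s1)" "code_at P (Suc a) ?P"
    using Loop_Suc.prems Loop_Suc.hyps by (auto simp: Let_def code_at_Cons code_at_append step_def)
  obtain t1 where t1: "(step P ^^ t1) (Suc a, s(r := s r - 1)) = (Suc a + length ?P, s1)"
    using Loop_Suc.IH(1)[OF *(3)] by blast
  obtain t2 where t2: "(step P ^^ t2) (a, s1) = (a + length (flatten (Loop r c) a), s2)"
    using Loop_Suc.IH(2)[OF Loop_Suc.prems] by blast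
  \<comment> \<open>Read from the right: one step for \<open>Dec\<close>, \<open>t1\<close> for the
    body, one for the jump back, \<open>t2\<close> for the remaining passes.\<close>
  have "(step P ^^ (t2 + (1 + (t1 + 1)))) (a, s) = (a + length (flatten (Loop r c) a), s2)"
    by (rule step_trans[OF step_trans[OF step_trans[OF _ t1]] t2]) (use * in auto)
  then show ?case by blast
qed

text \<open>The conventions are: input in register 0, output in register 1, scratch space from 2 on,
  halting at address \<open>length P\<close>.\<close>

lemma recf_result_program:
  obtains P where "\<And>x y. recf_result p [x] y \<Longrightarrow>
    \<exists>t s'. (step P ^^ t) (0, (\<lambda>_. 0)(0 := x)) = (length P, s') \<and> s' 1 = y"
proof (rule that)
  fix x y
  assume "recf_result p [x] y"
  then obtain s' where "big_step (com_of p [0] 1 2) ((\<lambda>_. 0)(0 := x)) s'" "s' 1 = y"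
    by (rule implementsD[OF implements_com_of, where s = "(\<lambda>_. 0)(0 := x)" and args = "[0]"
        and tgt = 1 and k = 2]) auto
  with flatten_correct[OF this(1), of "flatten (com_of p [0] 1 2) 0" 0]
  show "\<exists>t s'. (step (flatten (com_of p [0] 1 2) 0) ^^ t) (0, (\<lambda>_. 0)(0 := x)) =
      (length (flatten (com_of p [0] 1 2) 0), s') \<and> s' 1 = y"
    by (auto simp: code_at_def)
qed

section \<open>Difference polynomials as lists of terms\<close>

type_synonym 'a terms = "('a \<times> (nat \<times> nat) list) list"

definition poly_of :: "'a::field terms \<Rightarrow> 'a dpoly" where
  "poly_of ts = (\<Sum>(a, vs)\<leftarrow>ts. Poly_Mapping.single (\<Sum>v\<leftarrow>vs. Poly_Mapping.single v 1) a)"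

text \<open>The shifts are absorbed into the index, so an equation between sequences becomes one
  field equation at each index.\<close>

definition value_at :: "(nat \<Rightarrow> 'm::semiring_1 \<Rightarrow> 'a::field) \<Rightarrow> 'm \<Rightarrow> 'a terms \<Rightarrow> 'a" where
  "value_at x i ts = (\<Sum>(a, vs)\<leftarrow>ts. a * (\<Prod>v\<leftarrow>vs. x (fst v) (i + of_nat (snd v))))"

definition terms_over :: "'a::field set \<Rightarrow> nat \<Rightarrow> 'a terms \<Rightarrow> bool" where
  "terms_over K n ts \<longleftrightarrow> (\<forall>(a, vs)\<in>set ts. a \<in> K \<and> (\<forall>v\<in>set vs. fst v < n))"

text \<open>The coefficients are names here. The code is explicit so that its dependence on the
  input can be seen to be computable.\<close>

definition code_of :: "nat terms \<Rightarrow> nat" where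
  "code_of ts = list_encode
     (map (\<lambda>(a, vs). prod_encode (a, list_encode (map prod_encode vs))) ts)"

lemma value_at_simps [simp]:
  "value_at x i [] = 0"
  "value_at x i ((a, vs) # ts) =
    a * (\<Prod>v\<leftarrow>vs. x (fst v) (i + of_nat (snd v))) + value_at x i ts"
  "value_at x i (ts @ ts') = value_at x i ts + value_at x i ts'"
  by (simp_all add: value_at_def)

lemma funpow_seq_shift: "(seq_shift ^^ j) x i = x (i + of_nat j)"
  by (induction j arbitrary: i) (simp_all add: seq_shift_def add_ac)

lemma dpoly_eval_poly_of: "dpoly_eval x (poly_of ts) i = value_at x i ts"
proof -
  have mon: "dmonom_eval x (\<Sum>v\<leftarrow>vs. Poly_Mapping.single v 1) i =
      (\<Prod>v\<leftarrow>vs. x (fst v) (i + of_nat (snd v)))" for vs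
    by (induction vs) (simp_all add: dmonom_eval_add dmonom_eval_single funpow_seq_shift)
  show ?thesis
    by (induction ts)
      (auto simp: poly_of_def dpoly_eval_add dpoly_eval_single const_seq_def mon[simplified])
qed

lemma poly_of_in_dpolys:
  assumes "is_subfield K" "terms_over K n ts"
  shows "poly_of ts \<in> dpolys K n"
proof -
  have K: "0 \<in> K" "\<And>a b. a \<in> K \<Longrightarrow> b \<in> K \<Longrightarrow> a + b \<in> K"
    using assms(1) by (auto simp: is_subfield_def)
  have add: "f + g \<in> dpolys K n" if "f \<in> dpolys K n" "g \<in> dpolys K n" for f g
  proof -
    have "m \<in> Poly_Mapping.keys f \<or> m \<in> Poly_Mapping.keys g"
      if "m \<in> Poly_Mapping.keys (f + g)" for m
      using that Poly_Mapping.keys_add[of f g] by blast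
    then show ?thesis
      using that K(2) unfolding dpolys_def mem_Collect_eq lookup_add by blast
  qed
  have keys: "Poly_Mapping.keys (\<Sum>v\<leftarrow>vs. Poly_Mapping.single v (1::nat)) \<subseteq> set vs"
    for vs :: "(nat \<times> nat) list"
  proof (induction vs)
    case (Cons v vs)
    then show ?case
      using Poly_Mapping.keys_add[of "Poly_Mapping.single v (1::nat)"] by fastforce
  qed simp
  have single: "Poly_Mapping.single (\<Sum>v\<leftarrow>vs. Poly_Mapping.single v 1) a \<in> dpolys K n"
    if "a \<in> K" "\<forall>v\<in>set vs. fst v < n" for a vs
    using that K(1) keys[of vs] unfolding dpolys_def
    by (auto simp: lookup_single when_def split: if_splits)
  show ?thesis using assms(2)
  proof (induction ts)
    case Nil
    then show ?case using K(1) by (simp add: poly_of_def dpolys_def)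
  next
    case (Cons t ts)
    then show ?case
      by (cases t) (auto simp: poly_of_def terms_over_def intro!: add single[simplified])
  qed
qed

lemma decode_dpoly_code_of: "decode_dpoly \<nu> (code_of ts) = poly_of (map (apfst \<nu>) ts)"
proof -
  have "decode_dmonom (list_encode (map prod_encode vs)) = (\<Sum>v\<leftarrow>vs. Poly_Mapping.single v 1)" for vs
    by (simp add: decode_dmonom_def comp_def list_encode_inverse del: list_encode.simps)
  then show ?thesis
    by (simp add: decode_dpoly_def code_of_def poly_of_def list_encode_inverse comp_def
        case_prod_beta del: list_encode.simps)
qed

section \<open>Difference equations of a flat program\<close>

text \<open>
  Unknown \<open>0\<close> marks the starting time of a run, unknown \<open>3 r + 1\<close> is the content of register \<open>r\<close>,
  unknown \<open>3 r + 2\<close> its inverse, and unknown \<open>3 j + 3\<close> is \<open>1\<close> while the program counter is \<open>j\<close>.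
\<close>

abbreviation start :: "nat \<times> nat" where "start \<equiv> (0, 0)"
abbreviation reg :: "nat \<Rightarrow> nat \<Rightarrow> nat \<times> nat" where "reg r e \<equiv> (Suc (3 * r), e)"
abbreviation rinv :: "nat \<Rightarrow> nat \<times> nat" where "rinv r \<equiv> (Suc (Suc (3 * r)), 0)"
abbreviation pc :: "nat \<Rightarrow> nat \<Rightarrow> nat \<times> nat" where "pc j e \<equiv> (Suc (Suc (Suc (3 * j))), e)"

text \<open>The factor \<open>pc j 0\<close> in both terms makes the equation vacuous wherever this
  marker is zero. All equations in \<open>instr_eqs\<close> share this feature.\<close>

definition goto_eq :: "nat \<Rightarrow> nat \<Rightarrow> 'a::field terms" where
  "goto_eq j l = [(1, [pc j 0, pc l 1]), (-1, [pc j 0])]"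

definition keep_eq :: "nat \<Rightarrow> nat \<Rightarrow> 'a::field terms" where
  "keep_eq j r = [(1, [pc j 0, reg r 1]), (-1, [pc j 0, reg r 0])]"

text \<open>
  In the equations for \<open>Dec r l\<close>, the product of \<open>reg r\<close> and \<open>rinv r\<close> is forced to be \<open>0\<close> or \<open>1\<close>
  according to whether the register vanishes.
\<close>

fun instr_eqs :: "nat \<Rightarrow> nat \<Rightarrow> instr \<Rightarrow> 'a::field terms list" where
  "instr_eqs R j (IAssign d rs c) =
    [goto_eq j (Suc j),
     [(1, [pc j 0, reg d 1]), (- of_nat c, [pc j 0])] @ map (\<lambda>r. (-1, [pc j 0, reg r 0])) rs] @
    map (keep_eq j) (filter (\<lambda>r. r \<noteq> d) [0..<R])"
| "instr_eqs R j (Dec d l) =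
    [[(1, [pc j 0, reg d 0]), (-1, [pc j 0, reg d 0, reg d 0, rinv d])],
     [(1, [pc j 0, reg d 0, rinv d, pc (Suc j) 1]), (-1, [pc j 0, reg d 0, rinv d])],
     [(1, [pc j 0, pc l 1]), (-1, [pc j 0]), (-1, [pc j 0, reg d 0, rinv d, pc l 1]),
      (1, [pc j 0, reg d 0, rinv d])],
     [(1, [pc j 0, reg d 1]), (-1, [pc j 0, reg d 0]), (1, [pc j 0, reg d 0, rinv d])]] @
    map (keep_eq j) (filter (\<lambda>r. r \<noteq> d) [0..<R])"
| "instr_eqs R j (Jump l) = goto_eq j l # map (keep_eq j) [0..<R]"

text \<open>The second equation makes halting with an output other than 1 inconsistent. Register 0
  is left free at the start, to be fixed by \<open>input_eq\<close>.\<close>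

definition program_eqs :: "instr list \<Rightarrow> nat \<Rightarrow> 'a::field terms list" where
  "program_eqs P R =
    [[(1, [start, pc 0 0]), (-1, [start])],
     [(1, [pc (length P) 0, reg 1 0]), (-1, [pc (length P) 0])]] @
    map (\<lambda>r. [(1, [start, reg r 0])]) [1..<R] @
    concat (map (\<lambda>j. instr_eqs R j (P ! j)) [0..<length P])"

definition input_eq :: "nat \<Rightarrow> 'a::field terms" where
  "input_eq a = [(1, [start, reg 0 0]), (- of_nat a, [start])]"

definition solves :: "(nat \<Rightarrow> 'm::semiring_1 \<Rightarrow> 'a::field) \<Rightarrow> 'a terms list \<Rightarrow> bool" where
  "solves x E \<longleftrightarrow> (\<forall>ts\<in>set E. \<forall>i. value_at x i ts = 0)"

lemma solves_simps [simp]: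
  "solves x []"
  "solves x (ts # E) \<longleftrightarrow> (\<forall>i. value_at x i ts = 0) \<and> solves x E"
  "solves x (E @ E') \<longleftrightarrow> solves x E \<and> solves x E'"
  "solves x (concat Es) \<longleftrightarrow> (\<forall>E\<in>set Es. solves x E)"
  by (auto simp: solves_def)

lemma solves_map: "solves x (map f xs) \<longleftrightarrow> (\<forall>y\<in>set xs. \<forall>i. value_at x i (f y) = 0)"
  by (simp add: solves_def)

fun instr_regs :: "instr \<Rightarrow> nat set" where
  "instr_regs (IAssign d rs c) = insert d (set rs)"
| "instr_regs (Dec d l) = {d}"
| "instr_regs (Jump l) = {}"

lemma ex_register_bound: "\<exists>R\<ge>2. \<forall>ins\<in>set P. instr_regs ins \<subseteq> {..<R}"
proof -
  have "finite (instr_regs ins)" for ins by (cases ins) auto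
  then have "finite (\<Union>(instr_regs ` set P))" by simp
  then obtain R where "\<forall>r\<in>\<Union>(instr_regs ` set P). r < R"
    using finite_nat_set_iff_bounded by blast
  then show ?thesis by (intro exI[of _ "R + 2"]) fastforce
qed

section \<open>Solutions of the equations follow runs\<close>

definition agrees :: "nat \<Rightarrow> (nat \<Rightarrow> 'm \<Rightarrow> 'a::field) \<Rightarrow> 'm \<Rightarrow> nat \<times> (nat \<Rightarrow> nat) \<Rightarrow> bool" where
  "agrees R x i c \<longleftrightarrow> x (Suc (Suc (Suc (3 * fst c)))) i = 1 \<and>
     (\<forall>r<R. x (Suc (3 * r)) i = of_nat (snd c r))"

lemma value_at_minus_sum:
  "value_at x i (map (\<lambda>r. (-1, [pc j 0, reg r 0])) rs) =
    - (x (Suc (Suc (Suc (3 * j)))) i * (\<Sum>r\<leftarrow>rs. x (Suc (3 * r)) i))"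
  by (induction rs) (simp_all add: algebra_simps)

lemma of_nat_sum_list: "of_nat (sum_list (map f xs)) = (\<Sum>x\<leftarrow>xs. of_nat (f x))"
  by (induction xs) simp_all

text \<open>The marker of the current address is 1 and so activates the equations of its
  instruction; these determine the next registers and set the next marker.\<close>

lemma agrees_step:
  fixes x :: "nat \<Rightarrow> 'm::semiring_1 \<Rightarrow> 'a::field_char_0"
  assumes x: "solves x (program_eqs P R)" and regs: "\<forall>ins\<in>set P. instr_regs ins \<subseteq> {..<R}"
    and c: "agrees R x i c" "fst c < length P"
  shows "agrees R x (i + 1) (step P c)"
proof -
  obtain j s where js: "c = (j, s)" by (cases c)
  have j: "j < length P" and q: "x (Suc (Suc (Suc (3 * j)))) i = 1"
    and s: "\<And>r. r < R \<Longrightarrow> x (Suc (3 * r)) i = of_nat (s r)"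
    using c by (auto simp: js agrees_def)
  have eqs: "solves x (instr_eqs R j (P ! j))"
    using x j by (auto simp: program_eqs_def)
  have ins: "instr_regs (P ! j) \<subseteq> {..<R}" using regs j by simp
  have keep: "x (Suc (3 * r)) (i + 1) = of_nat (s r)"
    if "value_at x i (keep_eq j r) = 0" "r < R" for r
    using that s[of r] q by (simp add: keep_eq_def)
  have goto: "x (Suc (Suc (Suc (3 * l)))) (i + 1) = 1"
    if "value_at x i (goto_eq j l) = 0" for l
    using that q by (simp add: goto_eq_def)
  show ?thesis
  proof (cases "P ! j")
    case (IAssign d rs c)
    have "(\<Sum>r\<leftarrow>rs. x (Suc (3 * r)) i) = of_nat (sum_list (map s rs))"
      using ins IAssign s
      by (simp add: of_nat_sum_list subset_eq cong: map_cong)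
    moreover have "value_at x i ([(1, [pc j 0, reg d 1]), (- of_nat c, [pc j 0])] @
        map (\<lambda>r. (-1, [pc j 0, reg r 0])) rs) = 0"
      using eqs IAssign by simp
    ultimately have "x (Suc (3 * d)) (i + 1) = of_nat (sum_list (map s rs) + c)"
      by (simp add: value_at_minus_sum q add_eq_0_iff2)
    then show ?thesis
      using eqs IAssign keep goto[of "Suc j"] j by (auto simp: js step_def agrees_def solves_map)
  next
    case (Dec d l)
    let ?y = "x (Suc (Suc (3 * d))) i" and ?q = "\<lambda>l. x (Suc (Suc (Suc (3 * l)))) (i + 1)"
    have d: "x (Suc (3 * d)) i = of_nat (s d)" using ins Dec s by simp
    have inv: "of_nat (s d) = of_nat (s d) * of_nat (s d) * ?y"
      and suc: "of_nat (s d) * ?y * ?q (Suc j) = of_nat (s d) * ?y"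
      and jmp: "?q l - 1 - of_nat (s d) * ?y * ?q l + of_nat (s d) * ?y = 0"
      and val: "x (Suc (3 * d)) (i + 1) = of_nat (s d) - of_nat (s d) * ?y"
      using eqs Dec q d by (auto simp: algebra_simps dest!: spec[of _ i])
    have "agrees R x (i + 1) (exec (P ! j) (j, s))"
    proof (cases "s d = 0")
      case True
      then show ?thesis
        using eqs Dec keep jmp val by (auto simp: agrees_def solves_map)
    next
      case False
      \<comment> \<open>Cancelling is possible because a nonzero natural number stays nonzero in
        characteristic zero.\<close>
      then have "of_nat (s d) * ?y = 1" using inv by simp
      with False show ?thesis
        using eqs Dec keep suc val by (auto simp: agrees_def solves_map of_nat_diff)
    qed
    then show ?thesis using j by (simp add: js step_def)
  next
    case (Jump l)
    then show ?thesis
      using eqs keep goto j by (auto simp: js step_def agrees_def solves_map)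
  qed
qed

text \<open>The index advances with each genuine step but stays put once the counter has left the
  program, hence the mere existence of \<open>i'\<close>.\<close>

lemma agrees_run:
  fixes x :: "nat \<Rightarrow> 'm::semiring_1 \<Rightarrow> 'a::field_char_0"
  assumes "solves x (program_eqs P R)" "\<forall>ins\<in>set P. instr_regs ins \<subseteq> {..<R}" "agrees R x i c"
  shows "\<exists>i'. agrees R x i' ((step P ^^ t) c)"
proof (induction t)
  case (Suc t)
  then obtain i' where i': "agrees R x i' ((step P ^^ t) c)" by blast
  show ?case
  proof (cases "fst ((step P ^^ t) c) < length P")
    case True
    with agrees_step[OF assms(1,2) i'] show ?thesis by auto
  next
    case False
    then have "step P ((step P ^^ t) c) = (step P ^^ t) c" by (simp add: step_def[of P "(step P ^^ t) c"])
    with i' show ?thesis by auto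
  qed
qed (use assms(3) in auto)

section \<open>Solutions built from runs\<close>

text \<open>Over the integers, a run is extended by zeros to the times before it starts.\<close>

definition run_sol :: "(nat \<Rightarrow> nat \<times> (nat \<Rightarrow> nat)) \<Rightarrow> nat \<Rightarrow> 'm::semiring_char_0 \<Rightarrow> 'a::field_char_0" where
  "run_sol c u m = (if m \<in> range of_nat then
     case c (inv of_nat m) of (j, s) \<Rightarrow>
       if u = 0 then (if m = 0 then 1 else 0)
       else if u mod 3 = 1 then of_nat (s (u div 3))
       else if u mod 3 = 2 then inverse (of_nat (s (u div 3)))
       else if u = Suc (Suc (Suc (3 * j))) then 1 else 0
     else 0)"

lemma run_sol_simps:
  fixes m :: "'m::semiring_char_0"
  shows "run_sol c 0 (of_nat t :: 'm) = (if t = 0 then 1 else 0)"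
    and "run_sol c (Suc (3 * r)) (of_nat t :: 'm) = of_nat (snd (c t) r)"
    and "run_sol c (Suc (Suc (3 * r))) (of_nat t :: 'm) = inverse (of_nat (snd (c t) r))"
    and "run_sol c (Suc (Suc (Suc (3 * j)))) (of_nat t :: 'm) = (if fst (c t) = j then 1 else 0)"
    and "m \<notin> range of_nat \<Longrightarrow> run_sol c u m = 0"
proof -
  have [simp]: "inv of_nat (of_nat t :: 'm) = t" by (rule inv_f_f) (rule inj_of_nat)
  have [simp]: "Suc (3 * r) mod 3 = 1" "Suc (3 * r) div 3 = r"
    "Suc (Suc (3 * r)) mod 3 = 2" "Suc (Suc (3 * r)) div 3 = r"
    "Suc (Suc (Suc (3 * j))) mod 3 = 0" for r j :: nat
    by presburger+
  show "run_sol c 0 (of_nat t :: 'm) = (if t = 0 then 1 else 0)"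
    "run_sol c (Suc (3 * r)) (of_nat t :: 'm) = of_nat (snd (c t) r)"
    "run_sol c (Suc (Suc (3 * r))) (of_nat t :: 'm) = inverse (of_nat (snd (c t) r))"
    "run_sol c (Suc (Suc (Suc (3 * j)))) (of_nat t :: 'm) = (if fst (c t) = j then 1 else 0)"
    "m \<notin> range of_nat \<Longrightarrow> run_sol c u m = 0"
    by (auto simp: run_sol_def case_prod_beta)
qed

text \<open>These are the forms that simplification produces: \<open>of_nat t + 1\<close> is the
  shifted time, and \<open>6 + 3 * j\<close> is the unknown marking address
  \<open>Suc j\<close>.\<close>

lemma run_sol_Suc:
  fixes t :: nat
  defines "m \<equiv> of_nat t + 1 :: 'm::semiring_char_0"
  shows "run_sol c (Suc (3 * r)) m = of_nat (snd (c (Suc t)) r)"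
    and "run_sol c (Suc (Suc (Suc (3 * j)))) m = (if fst (c (Suc t)) = j then 1 else 0)"
    and "run_sol c (6 + 3 * j) m = (if fst (c (Suc t)) = Suc j then 1 else 0)"
proof -
  have m: "m = of_nat (Suc t)" by (simp add: m_def add.commute)
  show "run_sol c (Suc (3 * r)) m = of_nat (snd (c (Suc t)) r)"
    "run_sol c (Suc (Suc (Suc (3 * j)))) m = (if fst (c (Suc t)) = j then 1 else 0)"
    unfolding m by (rule run_sol_simps)+
  show "run_sol c (6 + 3 * j) m = (if fst (c (Suc t)) = Suc j then 1 else 0)"
    unfolding m using run_sol_simps(4)[of c "Suc j" "Suc t"] by (simp del: of_nat_Suc)
qed

lemma run_sol_solves_instr:
  assumes c: "\<And>t. c (Suc t) = step P (c t)" and j: "j < length P"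
  shows "solves (run_sol c :: nat \<Rightarrow> 'm::semiring_char_0 \<Rightarrow> 'a::field_char_0)
    (instr_eqs R j (P ! j))"
proof -
  have "value_at (run_sol c :: nat \<Rightarrow> 'm \<Rightarrow> 'a) m ts = 0" if ts: "ts \<in> set (instr_eqs R j (P ! j))"
    for m ts
  proof (cases "\<exists>t. m = of_nat t \<and> fst (c t) = j")
    case False
    \<comment> \<open>Either \<open>m\<close> is not a natural number and everything is zero, or the
      counter is not at \<open>j\<close>. In both cases each monomial has a zero factor.\<close>
    then have z: "run_sol c (Suc (Suc (Suc (3 * j)))) m = (0 :: 'a)"
      by (cases "m \<in> range of_nat") (auto simp: run_sol_simps)
    then have "\<forall>(a, vs)\<in>set ts. (\<Prod>v\<leftarrow>vs. run_sol c (fst v) (m + of_nat (snd v))) = (0 :: 'a)"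
      using ts by (cases "P ! j") (auto simp: goto_eq_def keep_eq_def)
    then show ?thesis
      by (induction ts) auto
  next
    case True
    then obtain t s where m: "m = of_nat t" and t: "c t = (j, s)" by (metis prod.collapse)
    have t': "c (Suc t) = exec (P ! j) (j, s)" using c[of t] t j by (simp add: step_def)
    \<comment> \<open>Since \<open>inverse 0 = 0\<close>, register times inverse indicates whether
      the register is nonzero.\<close>
    have inv: "of_nat n * inverse (of_nat n) = (if n = 0 then 0 else 1 :: 'a)"
      and pred: "of_nat (n - Suc 0) = (if n = 0 then 0 else of_nat n - 1 :: 'a)" for n
      by (auto simp: of_nat_diff)
    show ?thesis
      using ts t t' unfolding m
      by (cases "P ! j")
        (auto simp: goto_eq_def keep_eq_def run_sol_simps run_sol_Suc value_at_minus_sum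
          of_nat_sum_list inv pred mult.assoc split: if_splits)
  qed
  then show ?thesis by (auto simp: solves_def)
qed

text \<open>Wherever the start marker is nonzero, it can be cancelled and the first configuration is
  forced; the run then reaches the halting address, where the output equation applies. Conversely, a
  run with output 1 satisfies all equations.\<close>

lemma solvable_iff_output:
  assumes regs: "\<forall>ins\<in>set P. instr_regs ins \<subseteq> {..<R}" and R: "R \<ge> 2"
    and run: "(step P ^^ T) (0, (\<lambda>_. 0)(0 := a)) = (length P, s')"
  shows "(\<exists>x :: nat \<Rightarrow> 'm::semiring_char_0 \<Rightarrow> 'a::field_char_0.
      solves x (input_eq a # program_eqs P R) \<and> (\<exists>i. x 0 i \<noteq> 0)) \<longleftrightarrow> s' 1 = 1"
proof
  assume "\<exists>x :: nat \<Rightarrow> 'm \<Rightarrow> 'a.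
      solves x (input_eq a # program_eqs P R) \<and> (\<exists>i. x 0 i \<noteq> 0)"
  then obtain x :: "nat \<Rightarrow> 'm \<Rightarrow> 'a" and i where x: "solves x (program_eqs P R)"
    "\<And>i. value_at x i (input_eq a) = 0" and i: "x 0 i \<noteq> 0"
    by auto
  have "x (Suc (3 * r)) i = of_nat (((\<lambda>_. 0)(0 := a)) r)" if "r < R" for r
  proof (cases "r = 0")
    case True
    then show ?thesis using x(2)[of i] i by (simp add: input_eq_def)
  next
    case False
    then have "value_at x i [(1, [start, reg r 0])] = 0"
      using x(1) that by (auto simp: program_eqs_def solves_map)
    with False i show ?thesis by simp
  qed
  moreover have "x 3 i = 1"
    using x(1) i by (auto simp: program_eqs_def numeral_3_eq_3 dest!: spec[of _ i])
  ultimately have "agrees R x i (0, (\<lambda>_. 0)(0 := a))"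
    by (simp add: agrees_def numeral_3_eq_3)
  from agrees_run[OF x(1) regs this, of T] obtain i' where "agrees R x i' (length P, s')"
    by (auto simp: run)
  moreover have "value_at x i' [(1, [pc (length P) 0, reg 1 0]), (-1, [pc (length P) 0])] = 0"
    using x(1) by (simp add: program_eqs_def)
  moreover have "x (Suc (3 * 1)) i' = of_nat (s' 1)"
    using R calculation(1) unfolding agrees_def snd_conv by (metis less_le_trans one_less_numeral_iff semiring_norm(76))
  ultimately have "of_nat (s' 1) = (1 :: 'a)"
    by (simp add: agrees_def)
  then show "s' 1 = 1" by simp
next
  assume out: "s' 1 = 1"
  define c where "c t = (step P ^^ t) (0, (\<lambda>_. 0)(0 := a))" for t
  have stay: "(step P ^^ n) (length P, s) = (length P, s)" for n s
    by (induction n) (simp_all add: step_def)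
  \<comment> \<open>The counter may equal \<open>length P\<close> at a time other than
    \<open>T\<close>. Halted configurations are frozen, so the two are compared at time
    \<open>t + T\<close>.\<close>
  have halt: "snd (c t) 1 = 1" if halted: "fst (c t) = length P" for t
  proof -
    obtain s where s: "c t = (length P, s)" using halted by (cases "c t") auto
    have "(step P ^^ (T + t)) (0, (\<lambda>_. 0)(0 := a)) = (length P, s)"
      using s stay[of T s] by (simp add: funpow_add c_def)
    moreover have "(step P ^^ (t + T)) (0, (\<lambda>_. 0)(0 := a)) = (length P, s')"
      using run stay[of t s'] by (simp add: funpow_add)
    ultimately show ?thesis using s out by (simp add: add.commute)
  qed
  let ?x = "run_sol c :: nat \<Rightarrow> 'm \<Rightarrow> 'a"
  have c0: "c 0 = (0, (\<lambda>_. 0)(0 := a))" by (simp add: c_def)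
  \<comment> \<open>Equations carrying the start marker hold trivially except at index 0.\<close>
  have start0: "?x 0 m = 0 \<or> m = 0" for m
    by (cases "m \<in> range of_nat") (auto simp: run_sol_simps)
  have 0: "?x 0 0 = 1" "?x (Suc (3 * r)) 0 = of_nat (((\<lambda>_. 0)(0 := a)) r)" "?x (Suc (Suc (Suc 0))) 0 = 1" for r
    using run_sol_simps(1)[of c 0] run_sol_simps(2)[of c r 0] run_sol_simps(4)[of c 0 0]
    by (simp_all add: c0)
  have "value_at ?x m (input_eq a) = 0" for m
    using start0[of m] 0(1) 0(2)[of 0] by (auto simp: input_eq_def)
  moreover have "value_at ?x m [(1, [start, pc 0 0]), (-1, [start])] = 0" for m
    using start0[of m] 0 by auto
  moreover have "value_at ?x m [(1, [start, reg r 0])] = 0" if "r \<ge> 1" for m r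
    using start0[of m] 0(1) 0(2)[of r] that by auto
  moreover have "value_at ?x m [(1, [pc (length P) 0, reg 1 0]), (-1, [pc (length P) 0])] = 0" for m
  proof (cases "m \<in> range of_nat")
    case True
    then obtain t where m: "m = of_nat t" by blast
    show ?thesis using halt[of t] run_sol_simps(2)[of c 1 t] unfolding m
      by (auto simp: run_sol_simps)
  qed (simp add: run_sol_simps)
  moreover have "solves ?x (instr_eqs R j (P ! j))" if "j < length P" for j
    by (rule run_sol_solves_instr[OF _ that]) (simp add: c_def)
  ultimately have "solves ?x (input_eq a # program_eqs P R)"
    by (auto simp: program_eqs_def solves_map)
  with 0(1) show "\<exists>x :: nat \<Rightarrow> 'm \<Rightarrow> 'a.
      solves x (input_eq a # program_eqs P R) \<and> (\<exists>i. x 0 i \<noteq> 0)"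
    by (metis zero_neq_one)
qed

section \<open>Computability of the reduction\<close>

lemma recf_result_Comp1:
  "recf_result q xs y \<Longrightarrow> recf_result p [y] z \<Longrightarrow> recf_result (Comp p [q]) xs z"
  by (rule recf_result.Comp[where ys = "[y]"]) auto

lemma recf_result_Comp2:
  "recf_result q xs y \<Longrightarrow> recf_result q' xs y' \<Longrightarrow> recf_result p [y, y'] z \<Longrightarrow>
    recf_result (Comp p [q, q']) xs z"
  by (rule recf_result.Comp[where ys = "[y, y']"]) auto

lemma recf_result_Proj: "i < length xs \<Longrightarrow> xs ! i = y \<Longrightarrow> recf_result (Proj i) xs y"
  using recf_result.Proj by blast

lemma computable1_Comp2:
  assumes "computable2 h" "computable1 f" "computable1 g"
  shows "computable1 (\<lambda>x. h (f x) (g x))"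
proof -
  obtain p q r where "\<forall>x y. recf_result p [x, y] (h x y)" "\<forall>x. recf_result q [x] (f x)"
    "\<forall>x. recf_result r [x] (g x)"
    using assms by (auto simp: computable1_def computable2_def)
  then have "\<forall>x. recf_result (Comp p [q, r]) [x] (h (f x) (g x))"
    by (auto intro: recf_result_Comp2)
  then show ?thesis by (auto simp: computable1_def)
qed

text \<open>The constant is defined on lists of every length, including the empty list that the base
  case of a one-argument \<open>PrimRec\<close> receives.\<close>

lemma ex_recf_const: "\<exists>p. \<forall>xs. recf_result p xs n"
proof (induction n)
  case (Suc n)
  then obtain p where "\<forall>xs. recf_result p xs n" by blast
  then have "\<forall>xs. recf_result (Comp Succ [p]) xs (Suc n)"
    by (blast intro: recf_result_Comp1 recf_result.Succ)
  then show ?case by blast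
qed (use recf_result.Zero in blast)

lemma computable1_const: "computable1 (\<lambda>_. n)"
  using ex_recf_const unfolding computable1_def by blast

lemma computable1_id: "computable1 (\<lambda>x. x)"
  unfolding computable1_def using recf_result.Proj[of 0 "[_]"] by auto

lemma computable1_Suc:
  assumes "computable1 f"
  shows "computable1 (\<lambda>x. Suc (f x))"
proof -
  obtain p where "\<forall>x. recf_result p [x] (f x)" using assms by (auto simp: computable1_def)
  then have "\<forall>x. recf_result (Comp Succ [p]) [x] (Suc (f x))"
    by (blast intro: recf_result_Comp1 recf_result.Succ)
  then show ?thesis by (auto simp: computable1_def)
qed

lemma computable1_rec_nat:
  assumes "computable2 h"
  shows "computable1 (rec_nat a h)"
proof -
  obtain p where p: "\<And>x y. recf_result p [x, y] (h x y)"
    using assms by (auto simp: computable2_def)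
  obtain c where c: "\<And>xs. recf_result c xs a" using ex_recf_const by blast
  have "recf_result (PrimRec c p) [x] (rec_nat a h x)" for x
    by (induction x) (auto intro: recf_result.PrimRec_0 recf_result.PrimRec_Suc c p)
  then show ?thesis by (auto simp: computable1_def)
qed

text \<open>The pairing is \<open>triangle (x + y) + x\<close>; addition and triangular numbers come
  from primitive recursion.\<close>

lemma computable2_prod_encode: "computable2 (\<lambda>x y. prod_encode (x, y))"
proof -
  define add where "add = PrimRec (Proj 0) (Comp Succ [Proj 1])"
  have "recf_result (Comp Succ [Proj 1]) (n # r # xs) (Suc r)" for n r xs
    by (rule recf_result_Comp1[OF recf_result_Proj recf_result.Succ]) simp_all
  then have add: "recf_result add [x, y] (x + y)" for x y
    unfolding add_def using recf_result.Proj[of 0 "[y]"]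
    by (induction x) (auto intro: recf_result.PrimRec_0 recf_result.PrimRec_Suc)
  have suc: "recf_result (Comp Succ [Proj 0]) [n, r] (Suc n)" for n r
    by (rule recf_result_Comp1[OF recf_result_Proj recf_result.Succ]) simp_all
  have "recf_result (Comp add [Proj 1, Comp Succ [Proj 0]]) [n, r] (r + Suc n)" for n r
    by (rule recf_result_Comp2[OF recf_result_Proj suc add]) simp_all
  then have "computable2 (\<lambda>n r. r + Suc n)"
    unfolding computable2_def by blast
  from computable1_rec_nat[OF this, of 0]
  have "computable1 (rec_nat 0 (\<lambda>n r. r + Suc n))" .
  moreover have "rec_nat 0 (\<lambda>n r. r + Suc n) = triangle"
  proof
    show "rec_nat 0 (\<lambda>n r. r + Suc n) n = triangle n" for n
      by (induction n) simp_all
  qed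
  ultimately obtain tri where tri: "\<And>x. recf_result tri [x] (triangle x)"
    by (auto simp: computable1_def)
  have "recf_result (Comp add [Comp tri [add], Proj 0]) [x, y] (triangle (x + y) + x)" for x y
    by (rule recf_result_Comp2[OF recf_result_Comp1[OF add tri] recf_result_Proj add]) simp_all
  then have "recf_result (Comp add [Comp tri [add], Proj 0]) [x, y] (prod_encode (x, y))" for x y
    by (simp add: prod_encode_def)
  then show ?thesis unfolding computable2_def by blast
qed

lemma computable1_prod_encode:
  "computable1 f \<Longrightarrow> computable1 g \<Longrightarrow> computable1 (\<lambda>x. prod_encode (f x, g x))"
  by (rule computable1_Comp2[OF computable2_prod_encode])

lemma computable2_ignore_first:
  assumes "computable2 h"
  shows "computable2 (\<lambda>_ r. h r w)"
proof -
  obtain p where p: "\<And>x y. recf_result p [x, y] (h x y)"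
    using assms by (auto simp: computable2_def)
  obtain c where c: "\<And>xs. recf_result c xs w" using ex_recf_const by blast
  have "recf_result (Comp p [Proj 1, c]) [n, r] (h r w)" for n r
    by (rule recf_result_Comp2[OF recf_result_Proj c p]) simp_all
  then show ?thesis by (auto simp: computable2_def)
qed

section \<open>Undecidability\<close>

text \<open>Lengthening a list thus pushes its code above any prescribed number of unknowns.\<close>

lemma length_le_list_encode: "length xs \<le> list_encode xs"
proof (induction xs)
  case (Cons x xs)
  then show ?case using le_prod_encode_2[of "list_encode xs" x] by simp
qed simp

lemma ex_code_of:
  assumes "range \<nu> = K" "terms_over K n ts"
  shows "\<exists>c. decode_dpoly \<nu> c = poly_of ts"
proof -
  have "\<exists>ts'. map (apfst \<nu>) ts' = ts" using assms(2)
  proof (induction ts)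
    case (Cons t ts)
    obtain a vs where t: "t = (a, vs)" by (cases t)
    with Cons.prems assms(1) obtain b where "\<nu> b = a" by (auto simp: terms_over_def)
    moreover obtain ts' where "map (apfst \<nu>) ts' = ts"
      using Cons by (auto simp: terms_over_def)
    ultimately show ?case using t by (intro exI[of _ "(b, vs) # ts'"]) simp
  qed simp
  with decode_dpoly_code_of show ?thesis by metis
qed

lemma ex_terms_over:
  assumes "\<And>ts a vs. ts \<in> set E \<Longrightarrow> (a, vs) \<in> set ts \<Longrightarrow> a \<in> K"
  shows "\<exists>n. \<forall>ts\<in>set E. terms_over K n ts"
proof -
  let ?V = "\<Union>ts\<in>set E. \<Union>t\<in>set ts. fst ` set (snd t)"
  obtain n where "\<forall>u\<in>?V. u < n" 
    using finite_nat_set_iff_bounded[of ?V] by auto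
  with assms show ?thesis
    by (intro exI[of _ n]) (force simp: terms_over_def)
qed

lemma terms_over_mono: "terms_over K n ts \<Longrightarrow> n \<le> n' \<Longrightarrow> terms_over K n' ts"
  by (fastforce simp: terms_over_def)

lemma program_eqs_coeffs:
  fixes K :: "'a::field set"
  assumes K: "is_subfield K" and "ts \<in> set (program_eqs P R)" "(a, vs) \<in> set ts"
  shows "a \<in> K"
proof -
  have "1 \<in> K" "- 1 \<in> K" and neg: "- a \<in> K" if "a \<in> K" for a
    using K that by (auto simp: is_subfield_def)
  moreover have "of_nat c \<in> K" for c
    by (induction c) (use K in \<open>auto simp: is_subfield_def\<close>)
  moreover have "a \<in> {1, - 1} \<or> (\<exists>c. a = - of_nat c)"
    if "ts \<in> set (instr_eqs R j ins)" for j ins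
    using that assms(3) by (cases ins) (auto simp: goto_eq_def keep_eq_def)
  ultimately show ?thesis
    using assms(2,3) by (fastforce simp: program_eqs_def)
qed

text \<open>Passes from arbitrary families of sequences to the extensional tuples over which
  solutions range.\<close>

lemma value_at_restrict:
  assumes "terms_over K n ts"
  shows "value_at (restrict x {..<n}) i ts = value_at x i ts"
  using assms
proof (induction ts)
  case (Cons t ts)
  obtain a vs where t: "t = (a, vs)" by (cases t)
  have "(\<Prod>v\<leftarrow>vs. restrict x {..<n} (fst v) (i + of_nat (snd v))) =
      (\<Prod>v\<leftarrow>vs. x (fst v) (i + of_nat (snd v)))"
    by (rule arg_cong[where f = prod_list], rule map_cong)
      (use Cons.prems t in \<open>auto simp: terms_over_def\<close>)
  moreover have "value_at (restrict x {..<n}) i ts = value_at x i ts"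
    by (rule Cons.IH) (use Cons.prems in \<open>auto simp: terms_over_def\<close>)
  ultimately show ?case unfolding t value_at_simps by simp
qed simp

text \<open>The goal is the start marker, so a counterexample to the consequence is a solution in
  which a run starts. The extra polynomial 0 allows for padding of the system.\<close>

lemma holds_for_all_solutions_iff:
  fixes E :: "'a::field terms list"
  assumes E: "\<forall>ts\<in>set E. terms_over K n ts" and n: "0 < n"
  shows "holds_for_all_solutions TYPE('m::semiring_1) n (insert 0 (poly_of ` set E))
      (poly_of [(1, [start])]) \<longleftrightarrow>
    \<not> (\<exists>x :: nat \<Rightarrow> 'm \<Rightarrow> 'a. solves x E \<and> (\<exists>i. x 0 i \<noteq> 0))"
proof -
  have sol: "(\<forall>f\<in>insert 0 (poly_of ` set E). dpoly_eval x f = 0) \<longleftrightarrow> solves x E"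
    and goal: "dpoly_eval x (poly_of [(1, [start])]) = 0 \<longleftrightarrow> (\<forall>i. x 0 i = 0)"
    for x :: "nat \<Rightarrow> 'm \<Rightarrow> 'a"
    by (auto simp: solves_def fun_eq_iff dpoly_eval_poly_of)
  have "solves (restrict x {..<n}) E \<longleftrightarrow> solves x E" for x :: "nat \<Rightarrow> 'm \<Rightarrow> 'a"
    using E unfolding solves_def by (metis value_at_restrict)
  moreover have "restrict x {..<n} 0 = x 0" for x :: "nat \<Rightarrow> 'm \<Rightarrow> 'a"
    using n by simp
  moreover have "restrict x {..<n} \<in> {..<n} \<rightarrow>\<^sub>E UNIV" for x :: "nat \<Rightarrow> 'm \<Rightarrow> 'a"
    by auto
  ultimately show ?thesis
    unfolding holds_for_all_solutions_def sol goal by metis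
qed

text \<open>Any index semiring into which the natural numbers embed is allowed, which treats
  \<open>nat\<close> and \<open>int\<close> together.\<close>

lemma consequence_problem_undecidable:
  fixes k0 :: "'a::field_char_0 set"
  assumes k0: "is_subfield k0" and \<nu>: "computable_numbering k0 \<nu>"
  shows "\<not> consequence_problem_decidable TYPE('m::semiring_char_0) k0 \<nu>"
proof
  assume "consequence_problem_decidable TYPE('m) k0 \<nu>"
  then obtain p where p: "\<And>e n F g. decode_instance \<nu> e = (n, F, g) \<Longrightarrow> F \<subseteq> dpolys k0 n \<Longrightarrow>
      g \<in> dpolys k0 n \<Longrightarrow>
      recf_result p [e] (if holds_for_all_solutions TYPE('m) n F g then 1 else 0)"
    unfolding consequence_problem_decidable_def by blast
  have range: "range \<nu> = k0" using \<nu> by (simp add: computable_numbering_def)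
  have "0 \<in> range \<nu>" "1 \<in> range \<nu>" "- 1 \<in> range \<nu>"
    using k0 unfolding range by (auto simp: is_subfield_def)
  then obtain u w z where names: "\<nu> z = 0" "\<nu> u = 1" "\<nu> w = - 1" by (metis imageE)
  obtain h where h: "computable2 h" "\<And>x y. \<nu> (h x y) = \<nu> x + \<nu> y"
    using \<nu> by (auto simp: computable_numbering_def)

  \<comment> \<open>Adding the name of -1 repeatedly to the name of 0 yields names of negated
    natural numbers by primitive recursion.\<close>
  define neg where "neg = rec_nat z (\<lambda>_ r. h r w)"
  have neg: "\<nu> (neg a) = - of_nat a" for a
    by (induction a) (simp_all add: neg_def names h(2))
  have neg_comp: "computable1 neg"
    unfolding neg_def by (rule computable1_rec_nat[OF computable2_ignore_first[OF h(1)]])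
  define inp where "inp a = code_of [(u, [start, reg 0 0]), (neg a, [start])]" for a
  \<comment> \<open>The instance built from \<open>s\<close> has \<open>s\<close> unknowns and goal
    \<open>start\<close>; \<open>Suc (prod_encode (inp s, s))\<close> is the list coded by
    \<open>s\<close> with the input equation for \<open>s\<close> put in front.\<close>
  define H where "H s = prod_encode (s, prod_encode (Suc (prod_encode (inp s, s)),
      code_of [(u, [start])]))" for s
  have "computable1 H"
    unfolding H_def inp_def code_of_def list.map prod.case list_encode.simps
    by (intro computable1_prod_encode computable1_Suc computable1_id computable1_const neg_comp)
  then obtain q where q: "\<And>x. recf_result q [x] (H x)" by (auto simp: computable1_def)
  \<comment> \<open>This program computes \<open>H\<close> and then runs the supposed decision
    procedure on the resulting instance.\<close>
  obtain P where P: "\<And>x y. recf_result (Comp p [q]) [x] y \<Longrightarrow>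
      \<exists>t s'. (step P ^^ t) (0, (\<lambda>_. 0)(0 := x)) = (length P, s') \<and> s' 1 = y"
    using recf_result_program by blast
  obtain R where R: "R \<ge> 2" "\<forall>ins\<in>set P. instr_regs ins \<subseteq> {..<R}"
    using ex_register_bound by blast

  define E where "E = (program_eqs P R :: 'a terms list)"
  obtain n where n: "\<forall>ts\<in>set E. terms_over k0 n ts"
    using ex_terms_over[of E k0] program_eqs_coeffs[OF k0] unfolding E_def by blast
  have "\<exists>c. decode_dpoly \<nu> c = poly_of ts" if "ts \<in> set E" for ts
    using ex_code_of[OF range] n that by blast
  then obtain C where C: "\<And>ts. ts \<in> set E \<Longrightarrow> decode_dpoly \<nu> (C ts) = poly_of ts" by metis
  text \<open>The padding with codes of \<open>0\<close> makes the code \<open>s\<close> itself a bound on the unknowns.\<close>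
  define s where "s = list_encode (replicate (n + 2) 0 @ map C E)"
  \<comment> \<open>Besides the \<open>n\<close> unknowns of \<open>E\<close>, the summand 2
    provides for the unknowns 0 and 1 of the input equation.\<close>
  have s: "n + 2 \<le> s"
    using length_le_list_encode[of "replicate (n + 2) 0 @ map C E"] by (simp add: s_def)
  let ?E = "input_eq s # E"
  have "decode_dpoly \<nu> 0 = 0" by (simp add: decode_dpoly_def)
  \<comment> \<open>The number 0 codes the empty list of terms, so the padding contributes only the
    polynomial 0.\<close>
  then have "decode_dpoly \<nu> ` set (list_decode s) = insert 0 (poly_of ` set E)"
    unfolding s_def list_encode_inverse using C by (force simp: image_image)
  moreover have "list_decode (Suc (prod_encode (inp s, s))) = inp s # list_decode s"
    by simp
  ultimately have inst: "decode_instance \<nu> (H s) =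
      (s, insert 0 (poly_of ` set ?E), poly_of [(1, [start])])"
    by (simp add: decode_instance_def H_def inp_def decode_dpoly_code_of names neg input_eq_def
        insert_commute del: list_decode.simps)

  have "- of_nat a \<in> k0" for a
    using neg range by (metis rangeI)
  moreover have "1 \<in> k0" "0 \<in> k0" using k0 by (auto simp: is_subfield_def)
  ultimately have over: "\<forall>ts\<in>set ?E. terms_over k0 s ts" "terms_over k0 s [(1, [start])]"
    using n s by (auto simp: terms_over_def[of _ _ "_ # _"] input_eq_def intro: terms_over_mono)
  have "0 \<in> dpolys k0 s" using \<open>0 \<in> k0\<close> by (simp add: dpolys_def)
  then have "insert 0 (poly_of ` set ?E) \<subseteq> dpolys k0 s"
    using over poly_of_in_dpolys[OF k0] by blast
  note res = p[OF inst this poly_of_in_dpolys[OF k0 over(2)]]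
  have "recf_result (Comp p [q]) [s]
      (if holds_for_all_solutions TYPE('m) s (insert 0 (poly_of ` set ?E)) (poly_of [(1, [start])])
       then 1 else 0)"
    by (rule recf_result_Comp1[OF q res])
  \<comment> \<open>The program outputs 1 on \<open>s\<close> exactly if the procedure affirms the
    consequence, but output 1 also means that there is a solution with nonzero start marker, which
    refutes it.\<close>
  from P[OF this] solvable_iff_output[OF R(2,1), where ?'m = 'm and ?'a = 'a]
  have "(\<exists>x :: nat \<Rightarrow> 'm \<Rightarrow> 'a. solves x ?E \<and> (\<exists>i. x 0 i \<noteq> 0)) \<longleftrightarrow>
      holds_for_all_solutions TYPE('m) s (insert 0 (poly_of ` set ?E)) (poly_of [(1, [start])])"
    unfolding E_def by (fastforce split: if_splits)
  with holds_for_all_solutions_iff[OF over(1), where ?'m = 'm] s show False by auto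
qed

theorem theorem3p7:
  fixes k0 :: "'a::field_char_0 set" and \<nu> :: "nat \<Rightarrow> 'a"
  assumes "is_subfield k0"
    and "computable_numbering k0 \<nu>"
  shows "\<not> consequence_problem_decidable TYPE(nat) k0 \<nu> \<and>
         \<not> consequence_problem_decidable TYPE(int) k0 \<nu>"
  by (intro conjI consequence_problem_undecidable[OF assms])

end
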